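(* Let $0\neq\lambda\in kE$, scaled so that the coefficient $c_0$ of the identity element in $\lambda$ is $0$ (the $t=0$ case) or $1$ (the $t=1$ case). In both the $t=0$ and $t=1$ cases, the simple $H_\lambda$-modules over the $0$-fiber (that is, the simple quotients of $\Delta_0$) are $p$-dimensional if $\lambda\notin\operatorname{Rad}kE$, and $1$-dimensional if $\lambda\in\operatorname{Rad}kE$. The simple modules over the generic fiber (that is, the simple quotients of $\Delta_\alpha$ for $\alpha\neq0$) have dimension $q$ when $t=0$ and dimension $pq$ when $t=1$.
   Context: Let $p$ be an odd prime, $r\geq 1$, $q=p^r$, $k=\overline{\mathbb F}_q$, and $E=\left\{\begin{pmatrix}1&a\\0&1\end{pmatrix}: a\in\mathbb F_q\right\}\cong(\mathbb Z/p)^r$. Let $\xi$ generate $\mathbb F_q^\times$ and $g_i=\begin{pmatrix}1&\xi^{i-1}\\0&1\end{pmatrix}$, $i=1,\dots,r$ (generators of $E$). $E$ acts on $k\langle x,y\rangle$ by algebra automorphisms, $\begin{pmatrix}1&a\\0&1\end{pmatrix}$ fixing $x$ and sending $y\mapsto y+ax$; $k\langle x,y\rangle\rtimes E$ is the smash product, and $H_\lambda=(k\langle x,y\rangle\rtimes E)/(xy-yx-\lambda)$ for $\lambda\in kE$. Modules are left modules. For $\alpha\in k$, $\Delta_\alpha=H_\lambda/\bigl(H_\lambda(x-\alpha)+\sum_{i=1}^rH_\lambda(g_i-1)\bigr)$. $\operatorname{Rad}kE$ is the Jacobson radical of $kE$ (the augmentation ideal). Dimensions are over $k$. *)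

theory Defs
  imports
    "Jordan_Normal_Form.Matrix"
    "Jordan_Normal_Form.Missing_VectorSpace"
    "HOL-Library.Poly_Mapping"
    "HOL-Library.Cardinality"
    "HOL-Algebra.Algebraic_Closure_Type"
begin

hide_const (open) Polynomial.smult Divisibility.prime

section \<open>Left modules over a not necessarily commutative ring\<close>

text \<open>
  The locales \<open>module\<close> of HOL-Algebra require a commutative ring of scalars; the record type,
  \<^const>\<open>Module.submodule\<close> and \<^const>\<open>module_hom\<close> do not and are reused here. The fields
  \<open>mult\<close> and \<open>one\<close> of the module record play no role.
\<close>

locale left_module = R?: ring R + M?: abelian_group M
  for R :: "('a, 'c) ring_scheme" and M :: "('a, 'b) module" (structure) +
  assumes smult_closed:
      "\<lbrakk>a \<in> carrier R; x \<in> carrier M\<rbrakk> \<Longrightarrow> a \<odot>\<^bsub>M\<^esub> x \<in> carrier M"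
    and smult_l_distr:
      "\<lbrakk>a \<in> carrier R; b \<in> carrier R; x \<in> carrier M\<rbrakk> \<Longrightarrow>
        (a \<oplus>\<^bsub>R\<^esub> b) \<odot>\<^bsub>M\<^esub> x = a \<odot>\<^bsub>M\<^esub> x \<oplus>\<^bsub>M\<^esub> b \<odot>\<^bsub>M\<^esub> x"
    and smult_r_distr:
      "\<lbrakk>a \<in> carrier R; x \<in> carrier M; y \<in> carrier M\<rbrakk> \<Longrightarrow>
        a \<odot>\<^bsub>M\<^esub> (x \<oplus>\<^bsub>M\<^esub> y) = a \<odot>\<^bsub>M\<^esub> x \<oplus>\<^bsub>M\<^esub> a \<odot>\<^bsub>M\<^esub> y"
    and smult_assoc:
      "\<lbrakk>a \<in> carrier R; b \<in> carrier R; x \<in> carrier M\<rbrakk> \<Longrightarrow>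
        (a \<otimes>\<^bsub>R\<^esub> b) \<odot>\<^bsub>M\<^esub> x = a \<odot>\<^bsub>M\<^esub> (b \<odot>\<^bsub>M\<^esub> x)"
    and smult_one:
      "x \<in> carrier M \<Longrightarrow> \<one>\<^bsub>R\<^esub> \<odot>\<^bsub>M\<^esub> x = x"

definition regular_module :: "('a, 'c) ring_scheme \<Rightarrow> ('a, 'a) module" where
  "regular_module R = \<lparr>carrier = carrier R, mult = mult R, one = one R,
     zero = zero R, add = add R, smult = mult R\<rparr>"

text \<open>
  The action on cosets follows the pattern of \<^const>\<open>rcoset_mult\<close>: for a submodule \<open>N\<close>, all the
  cosets in the union coincide.
\<close>

definition quotient_module ::
    "('a, 'c) ring_scheme \<Rightarrow> ('a, 'b) module \<Rightarrow> 'b set \<Rightarrow> ('a, 'b set) module" where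
  "quotient_module R M N = \<lparr>carrier = a_rcosets\<^bsub>M\<^esub> N, mult = undefined, one = undefined,
     zero = N, add = set_add M, smult = (\<lambda>a C. \<Union>m\<in>C. N +>\<^bsub>M\<^esub> (a \<odot>\<^bsub>M\<^esub> m))\<rparr>"

lemma left_module_regular_module:
  assumes "ring R"
  shows "left_module R (regular_module R)"
proof -
  interpret ring R by fact
  have "abelian_group (regular_module R)"
    by (rule abelian_groupI)
      (auto simp: regular_module_def a_ac intro: a_inv_closed l_neg)
  then show ?thesis
    by (intro left_module.intro left_module_axioms.intro ring_axioms)
      (simp_all add: regular_module_def l_distr r_distr m_assoc)
qed

lemma (in left_module) smult_coset:
  assumes N: "Module.submodule N R M" and a: "a \<in> carrier R" and x: "x \<in> carrier M"
  shows "(\<Union>m\<in>N +>\<^bsub>M\<^esub> x. N +>\<^bsub>M\<^esub> (a \<odot>\<^bsub>M\<^esub> m)) = N +>\<^bsub>M\<^esub> (a \<odot>\<^bsub>M\<^esub> x)"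
proof -
  interpret N: Module.submodule N R M by fact
  interpret N: abelian_subgroup N M
    by (intro abelian_subgroupI3 additive_subgroup.intro N.subgroup_axioms M.abelian_group_axioms)
  have eq: "N +>\<^bsub>M\<^esub> (a \<odot>\<^bsub>M\<^esub> m) = N +>\<^bsub>M\<^esub> (a \<odot>\<^bsub>M\<^esub> x)" if m: "m \<in> N +>\<^bsub>M\<^esub> x" for m
  proof -
    obtain n where n: "n \<in> N" "m = n \<oplus>\<^bsub>M\<^esub> x"
      using m by (auto simp: a_r_coset_def')
    have "n \<in> carrier M" using n N.a_subset by auto
    then have "a \<odot>\<^bsub>M\<^esub> m = a \<odot>\<^bsub>M\<^esub> n \<oplus>\<^bsub>M\<^esub> a \<odot>\<^bsub>M\<^esub> x"
      using n a x by (simp add: smult_r_distr)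
    moreover have "a \<odot>\<^bsub>M\<^esub> n \<in> N" using a n(1) by (rule N.smult_closed)
    ultimately have "a \<odot>\<^bsub>M\<^esub> m \<in> N +>\<^bsub>M\<^esub> (a \<odot>\<^bsub>M\<^esub> x)"
      by (auto simp: a_r_coset_def')
    then show ?thesis
      using a x by (intro N.a_repr_independence'[symmetric] smult_closed)
  qed
  have "x \<in> N +>\<^bsub>M\<^esub> x" using x by (rule N.a_rcos_self)
  then show ?thesis using eq by blast
qed

lemma (in left_module) left_module_quotient_module:
  assumes N: "Module.submodule N R M"
  shows "left_module R (quotient_module R M N)"
proof -
  interpret N: Module.submodule N R M by fact
  interpret N: abelian_subgroup N M
    by (intro abelian_subgroupI3 additive_subgroup.intro N.subgroup_axioms M.abelian_group_axioms)
  let ?Q = "quotient_module R M N"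
  have carr: "carrier ?Q = {N +>\<^bsub>M\<^esub> x |x. x \<in> carrier M}"
    by (auto simp: quotient_module_def A_RCOSETS_def' )
  have add: "(N +>\<^bsub>M\<^esub> x) \<oplus>\<^bsub>?Q\<^esub> (N +>\<^bsub>M\<^esub> y) = N +>\<^bsub>M\<^esub> (x \<oplus>\<^bsub>M\<^esub> y)"
    if "x \<in> carrier M" "y \<in> carrier M" for x y
    using that by (simp add: quotient_module_def N.a_rcos_sum)
  have smult: "a \<odot>\<^bsub>?Q\<^esub> (N +>\<^bsub>M\<^esub> x) = N +>\<^bsub>M\<^esub> (a \<odot>\<^bsub>M\<^esub> x)"
    if "a \<in> carrier R" "x \<in> carrier M" for a x
    using smult_coset[OF N that] by (simp add: quotient_module_def)
  have zero: "\<zero>\<^bsub>?Q\<^esub> = N +>\<^bsub>M\<^esub> \<zero>\<^bsub>M\<^esub>"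
    using N.a_subset by (simp add: quotient_module_def)
  have carrI: "N +>\<^bsub>M\<^esub> x \<in> carrier ?Q" if "x \<in> carrier M" for x
    using that by (auto simp: carr)
  have carrE: thesis if "C \<in> carrier ?Q" "\<And>x. x \<in> carrier M \<Longrightarrow> C = N +>\<^bsub>M\<^esub> x \<Longrightarrow> thesis" for C thesis
    using that by (auto simp: carr)
  have "abelian_group ?Q"
  proof (rule abelian_groupI)
    fix C assume "C \<in> carrier ?Q"
    then obtain x where "x \<in> carrier M" "C = N +>\<^bsub>M\<^esub> x" by (auto simp: carr)
    then show "\<exists>D\<in>carrier ?Q. D \<oplus>\<^bsub>?Q\<^esub> C = \<zero>\<^bsub>?Q\<^esub>"
      by (intro bexI[of _ "N +>\<^bsub>M\<^esub> (\<ominus>\<^bsub>M\<^esub> x)"]) (auto simp: carr add zero M.l_neg)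
  qed (auto elim!: carrE intro!: carrI simp: add zero M.a_ac)
  then show ?thesis
    by (intro left_module.intro left_module_axioms.intro R.ring_axioms)
      (auto elim!: carrE intro!: carrI simp: add smult smult_closed smult_l_distr smult_r_distr smult_assoc smult_one)
qed

definition simple_module :: "('a, 'c) ring_scheme \<Rightarrow> ('a, 'b) module \<Rightarrow> bool" where
  "simple_module R V \<longleftrightarrow> left_module R V \<and> carrier V \<noteq> {\<zero>\<^bsub>V\<^esub>} \<and>
     (\<forall>N. Module.submodule N R V \<longrightarrow> N = {\<zero>\<^bsub>V\<^esub>} \<or> N = carrier V)"

definition is_quotient_of ::
    "('a, 'c) ring_scheme \<Rightarrow> ('a, 'v) module \<Rightarrow> ('a, 'b) module \<Rightarrow> bool" where
  "is_quotient_of R V M \<longleftrightarrow> (\<exists>h \<in> module_hom R M V. h ` carrier M = carrier V)"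

text \<open>For commutative rings only, where left and two-sided maximal ideals agree.\<close>

definition jacobson_radical :: "('a, 'c) ring_scheme \<Rightarrow> 'a set" where
  "jacobson_radical R = carrier R \<inter> \<Inter> {I. maximalideal I R}"


section \<open>The free algebra in two generators\<close>

datatype letter = Lx | Ly

datatype word = Word (letters: "letter list")

instantiation word :: monoid_add
begin
definition "0 = Word []"
definition "u + v = Word (letters u @ letters v)"
instance by standard (auto simp: zero_word_def plus_word_def)
end

text \<open>
  The monoid algebra of the free monoid \<^typ>\<open>word\<close>; concatenation is written additively because
  the convolution product of \<^type>\<open>poly_mapping\<close> uses addition of indices.
\<close>

type_synonym 'k free_alg = "word \<Rightarrow>\<^sub>0 'k"

definition fconst :: "'k::comm_ring_1 \<Rightarrow> 'k free_alg" where
  "fconst c = Poly_Mapping.single 0 c"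

definition fgen :: "letter \<Rightarrow> 'k::comm_ring_1 free_alg" where
  "fgen l = Poly_Mapping.single (Word [l]) 1"

text \<open>The algebra endomorphism with \<open>x \<mapsto> \<sigma> Lx\<close> and \<open>y \<mapsto> \<sigma> Ly\<close>.\<close>

definition fsubst :: "(letter \<Rightarrow> 'k free_alg) \<Rightarrow> 'k::comm_ring_1 free_alg \<Rightarrow> 'k free_alg" where
  "fsubst \<sigma> f = (\<Sum>w\<in>Poly_Mapping.keys f.
     fconst (Poly_Mapping.lookup f w) * prod_list (map \<sigma> (letters w)))"

lemma poly_mapping_single_add_induct [case_names single add]:
  fixes f :: "'a \<Rightarrow>\<^sub>0 'b::comm_monoid_add"
  assumes "\<And>k v. P (Poly_Mapping.single k v)" and "\<And>f g. P f \<Longrightarrow> P g \<Longrightarrow> P (f + g)"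
  shows "P f"
proof (induction f rule: Poly_Mapping.update_induct)
  case const
  show ?case using assms(1)[of undefined 0] by simp
next
  case (update f a b)
  have "Poly_Mapping.update a b f = Poly_Mapping.single a b + f"
    using update(1)
    by (intro poly_mapping_eqI) (auto simp: lookup_update lookup_add lookup_single when_def in_keys_iff)
  then show ?case using assms update by simp
qed

lemma fconst_simps [simp]:
  "fconst 0 = 0" "fconst 1 = 1" "fconst (a + b) = fconst a + fconst b"
  "fconst (a * b) = fconst a * fconst b"
  by (simp_all add: fconst_def single_add mult_single)

lemma fconst_commute: "fconst c * f = f * fconst c"
  by (induction f rule: poly_mapping_single_add_induct)
    (simp_all add: fconst_def mult_single distrib_left distrib_right mult.commute)

lemma fsubst_single: "fsubst \<sigma> (Poly_Mapping.single w c) = fconst c * prod_list (map \<sigma> (letters w))"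
  by (simp add: fsubst_def)

lemma fsubst_add: "fsubst \<sigma> (f + g) = fsubst \<sigma> f + fsubst \<sigma> g"
  unfolding fsubst_def by (rule setsum_keys_plus_distrib) (simp_all add: distrib_right)

lemma fsubst_zero [simp]: "fsubst \<sigma> 0 = 0"
  by (simp add: fsubst_def)

lemma fsubst_mult: "fsubst \<sigma> (f * g) = fsubst \<sigma> f * fsubst \<sigma> g"
proof (induction f rule: poly_mapping_single_add_induct)
  case (single u a)
  show ?case
  proof (induction g rule: poly_mapping_single_add_induct)
    case (single w b)
    let ?U = "prod_list (map \<sigma> (letters u))" and ?W = "prod_list (map \<sigma> (letters w))"
    have "fsubst \<sigma> (Poly_Mapping.single u a * Poly_Mapping.single w b) =
        fconst a * (fconst b * ?U) * ?W"
      by (simp add: mult_single fsubst_single plus_word_def mult.assoc)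
    also have "\<dots> = fconst a * (?U * fconst b) * ?W"
      by (simp only: fconst_commute[of b])
    also have "\<dots> = fsubst \<sigma> (Poly_Mapping.single u a) * fsubst \<sigma> (Poly_Mapping.single w b)"
      by (simp add: fsubst_single mult.assoc)
    finally show ?case .
  qed (simp add: distrib_left fsubst_add)
qed (simp add: distrib_right fsubst_add)

lemma fsubst_fconst [simp]: "fsubst \<sigma> (fconst c) = fconst c"
  by (simp add: fconst_def[of c] fsubst_single zero_word_def[symmetric])
     (simp add: zero_word_def)

lemma fsubst_one [simp]: "fsubst \<sigma> 1 = 1"
  using fsubst_fconst[of \<sigma> 1] by simp

lemma fsubst_fgen [simp]: "fsubst \<sigma> (fgen l) = \<sigma> l"
  by (simp add: fgen_def fsubst_single)

lemma fsubst_prod_list: "fsubst \<sigma> (prod_list fs) = prod_list (map (fsubst \<sigma>) fs)"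
  by (induction fs) (simp_all add: fsubst_mult)

lemma fsubst_fsubst: "fsubst \<sigma> (fsubst \<tau> f) = fsubst (\<lambda>l. fsubst \<sigma> (\<tau> l)) f"
  by (induction f rule: poly_mapping_single_add_induct)
    (simp_all add: fsubst_add fsubst_single fsubst_mult fsubst_prod_list comp_def)

lemma prod_list_fgen: "prod_list (map fgen ls) = Poly_Mapping.single (Word ls) 1"
proof (induction ls)
  case Nil
  show ?case by (simp flip: zero_word_def)
qed (simp add: fgen_def mult_single plus_word_def)

lemma fsubst_id: "fsubst fgen f = f"
  by (induction f rule: poly_mapping_single_add_induct)
    (simp_all add: fsubst_add fsubst_single prod_list_fgen fconst_def mult_single)


section \<open>The group and its action\<close>

text \<open>
  Throughout, the finite field is a type \<open>'f\<close> and its algebraic closure is \<^typ>\<open>'f alg_closure\<close>,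
  with inclusion \<^const>\<open>to_ac\<close>. The matrix \<open>unip a\<close> is denoted by its entry \<open>a\<close>, so the group of
  these matrices is the additive group of \<open>'f\<close>, and its group algebra is the convolution algebra
  \<^typ>\<open>'f \<Rightarrow>\<^sub>0 'f alg_closure\<close>.
\<close>

definition unip :: "'f::field \<Rightarrow> 'f mat" where
  "unip a = mat_of_rows_list 2 [[1, a], [0, 1]]"

lemma unip_mult: "unip a * unip b = unip (a + b)"
  by (rule eq_matI)
    (auto simp: unip_def mat_of_rows_list_def scalar_prod_def less_2_cases_iff numeral_2_eq_2 less_Suc_eq)

lemma unip_zero: "unip 0 = 1\<^sub>m 2"
  by (rule eq_matI)
    (auto simp: unip_def mat_of_rows_list_def numeral_2_eq_2 less_Suc_eq)

lemma inj_unip: "inj unip"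
proof (rule injI)
  fix a b :: 'a
  assume "unip a = unip b"
  then have "unip a $$ (0, 1) = unip b $$ (0, 1)" by simp
  then show "a = b" by (simp add: unip_def mat_of_rows_list_def)
qed

type_synonym 'f group_alg = "'f \<Rightarrow>\<^sub>0 'f alg_closure"

definition act :: "'f::field \<Rightarrow> 'f alg_closure free_alg \<Rightarrow> 'f alg_closure free_alg" where
  "act a = fsubst (\<lambda>l. case l of Lx \<Rightarrow> fgen Lx | Ly \<Rightarrow> fgen Ly + fconst (to_ac a) * fgen Lx)"

lemma act_simps [simp]:
  "act a 0 = 0" "act a 1 = 1" "act a (fconst c) = fconst c" "act a (fgen Lx) = fgen Lx"
  "act a (fgen Ly) = fgen Ly + fconst (to_ac a) * fgen Lx"
  by (simp_all add: act_def)

lemma act_add: "act a (f + g) = act a f + act a g"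
  by (simp add: act_def fsubst_add)

lemma act_mult: "act a (f * g) = act a f * act a g"
  by (simp add: act_def fsubst_mult)

lemma act_zero [simp]: "act 0 f = f"
proof -
  have "act 0 f = fsubst fgen f"
    unfolding act_def
    by (intro arg_cong[where f = "\<lambda>\<sigma>. fsubst \<sigma> f"]) (auto simp: fun_eq_iff split: letter.split)
  then show ?thesis by (simp add: fsubst_id)
qed

lemma act_act: "act a (act b f) = act (a + b) f"
proof -
  have "act a (act b f) = fsubst (\<lambda>l. act a (case l of Lx \<Rightarrow> fgen Lx | Ly \<Rightarrow> fgen Ly + fconst (to_ac b) * fgen Lx)) f"
    unfolding act_def by (rule fsubst_fsubst)
  also have "\<dots> = act (a + b) f"
    unfolding act_def[of "a + b"]
    by (intro arg_cong[where f = "\<lambda>\<sigma>. fsubst \<sigma> f"])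
      (auto simp: fun_eq_iff act_add act_mult distrib_right split: letter.split)
  finally show ?thesis .
qed


section \<open>The smash product\<close>

text \<open>
  An element \<open>\<Sum>\<^sub>g f\<^sub>g g\<close> with \<open>f\<^sub>g\<close> in the free algebra is the finitely supported
  function \<open>g \<mapsto> f\<^sub>g\<close>; the product is given by \<open>(f g) (f' g') = f (g \<cdot> f') (g g')\<close>.
\<close>

type_synonym 'f smash = "'f \<Rightarrow>\<^sub>0 'f alg_closure free_alg"

definition smash_mult :: "'f::field smash \<Rightarrow> 'f smash \<Rightarrow> 'f smash" where
  "smash_mult P Q = (\<Sum>g\<in>Poly_Mapping.keys P. \<Sum>h\<in>Poly_Mapping.keys Q.
     Poly_Mapping.single (g + h) (Poly_Mapping.lookup P g * act g (Poly_Mapping.lookup Q h)))"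

definition smash_ring :: "'f::field smash ring" where
  "smash_ring = \<lparr>carrier = UNIV, mult = smash_mult, one = Poly_Mapping.single 0 1,
     zero = 0, add = (+)\<rparr>"

lemma smash_mult_single [simp]:
  "smash_mult (Poly_Mapping.single g f) (Poly_Mapping.single h f') =
     Poly_Mapping.single (g + h) (f * act g f')"
  by (simp add: smash_mult_def)

lemma smash_mult_add_left: "smash_mult (P + Q) R = smash_mult P R + smash_mult Q R"
  unfolding smash_mult_def
  by (rule setsum_keys_plus_distrib) (simp_all add: distrib_right single_add sum.distrib)

lemma smash_mult_add_right: "smash_mult P (Q + R) = smash_mult P Q + smash_mult P R"
  unfolding smash_mult_def sum.distrib[symmetric]
  by (intro sum.cong refl setsum_keys_plus_distrib) (simp_all add: act_add distrib_left single_add)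

lemma smash_mult_assoc: "smash_mult (smash_mult P Q) R = smash_mult P (smash_mult Q R)"
proof (induction P rule: poly_mapping_single_add_induct)
  case (single g f)
  show ?case
  proof (induction Q rule: poly_mapping_single_add_induct)
    case (single h f')
    show ?case
      by (induction R rule: poly_mapping_single_add_induct)
        (simp_all add: smash_mult_add_right act_mult act_act add.assoc mult.assoc)
  qed (simp add: smash_mult_add_left smash_mult_add_right)
qed (simp add: smash_mult_add_left)

lemma smash_mult_one_left: "smash_mult (Poly_Mapping.single 0 1) P = P"
  by (induction P rule: poly_mapping_single_add_induct)
    (simp_all add: smash_mult_add_right del: single_one)

lemma smash_mult_one_right: "smash_mult P (Poly_Mapping.single 0 1) = P"
  by (induction P rule: poly_mapping_single_add_induct)
    (simp_all add: smash_mult_add_left del: single_one)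

lemma ring_smash_ring: "ring (smash_ring :: 'f::field smash ring)"
proof (rule ringI)
  show "abelian_group (smash_ring :: 'f smash ring)"
  proof (rule abelian_groupI)
    fix P :: "'f smash" assume "P \<in> carrier smash_ring"
    show "\<exists>Q\<in>carrier smash_ring. Q \<oplus>\<^bsub>smash_ring\<^esub> P = \<zero>\<^bsub>smash_ring\<^esub>"
      by (rule bexI[of _ "- P"]) (simp_all add: smash_ring_def)
  qed (simp_all add: smash_ring_def add_ac)
  show "Group.monoid (smash_ring :: 'f smash ring)"
    by (rule monoidI) (simp_all add: smash_ring_def smash_mult_assoc smash_mult_one_left smash_mult_one_right del: single_one)
qed (simp_all add: smash_ring_def smash_mult_add_left smash_mult_add_right)

definition of_free :: "'f::field alg_closure free_alg \<Rightarrow> 'f smash" where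
  "of_free f = Poly_Mapping.single 0 f"

definition of_group_alg :: "'f::field group_alg \<Rightarrow> 'f smash" where
  "of_group_alg u = Poly_Mapping.map fconst u"

definition of_group :: "'f::field \<Rightarrow> 'f smash" where
  "of_group a = Poly_Mapping.single a 1"


section \<open>The algebra \<open>H\<^sub>\<lambda>\<close>\<close>

definition H_ideal :: "'f::field group_alg \<Rightarrow> 'f smash set" where
  "H_ideal lam = Idl\<^bsub>smash_ring\<^esub>
     {of_free (fgen Lx * fgen Ly - fgen Ly * fgen Lx) - of_group_alg lam}"

definition H_alg :: "'f::field group_alg \<Rightarrow> 'f smash set ring" where
  "H_alg lam = smash_ring Quot H_ideal lam"

definition H_class :: "'f::field group_alg \<Rightarrow> 'f smash \<Rightarrow> 'f smash set" where
  "H_class lam P = H_ideal lam +>\<^bsub>smash_ring\<^esub> P"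

lemma ideal_H_ideal: "ideal (H_ideal lam) smash_ring"
  unfolding H_ideal_def by (rule ring.genideal_ideal[OF ring_smash_ring]) (simp add: smash_ring_def)

lemma ring_H_alg: "ring (H_alg lam)"
  unfolding H_alg_def by (rule ideal.quotient_is_ring[OF ideal_H_ideal])

lemma H_class_hom: "H_class lam \<in> ring_hom smash_ring (H_alg lam)"
proof -
  have "H_class lam = (+>\<^bsub>smash_ring\<^esub>) (H_ideal lam)"
    by (simp add: fun_eq_iff H_class_def)
  then show ?thesis
    using ideal.rcos_ring_hom[OF ideal_H_ideal] by (simp add: H_alg_def)
qed


section \<open>The modules \<open>\<Delta>\<^sub>\<alpha>\<close>\<close>

definition Delta_ideal ::
    "'f::field group_alg \<Rightarrow> 'f \<Rightarrow> nat \<Rightarrow> 'f alg_closure \<Rightarrow> 'f smash set set" where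
  "Delta_ideal lam \<xi> r \<alpha> =
     {b \<otimes>\<^bsub>H_alg lam\<^esub> H_class lam (of_free (fgen Lx - fconst \<alpha>)) \<oplus>\<^bsub>H_alg lam\<^esub>
        (\<Oplus>\<^bsub>H_alg lam\<^esub> i\<in>{1..r}. c i \<otimes>\<^bsub>H_alg lam\<^esub> H_class lam (of_group (\<xi> ^ (i - 1)) - of_group 0))
      | b c. b \<in> carrier (H_alg lam) \<and> c \<in> {1..r} \<rightarrow> carrier (H_alg lam)}"

definition Delta ::
    "'f::field group_alg \<Rightarrow> 'f \<Rightarrow> nat \<Rightarrow> 'f alg_closure \<Rightarrow> ('f smash set, 'f smash set set) module" where
  "Delta lam \<xi> r \<alpha> =
     quotient_module (H_alg lam) (regular_module (H_alg lam)) (Delta_ideal lam \<xi> r \<alpha>)"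

lemma submodule_Delta_ideal:
  "Module.submodule (Delta_ideal lam \<xi> r \<alpha>) (H_alg lam) (regular_module (H_alg lam))"
proof -
  let ?H = "H_alg lam" and ?M = "regular_module (H_alg lam)"
  interpret H: ring ?H by (rule ring_H_alg)
  define xa where "xa = H_class lam (of_free (fgen Lx - fconst \<alpha>))"
  define G where "G i = H_class lam (of_group (\<xi> ^ (i - 1)) - of_group 0)" for i :: nat
  have xa: "xa \<in> carrier ?H" and G: "G i \<in> carrier ?H" for i
    using H_class_hom[of lam] by (auto simp: xa_def G_def ring_hom_def smash_ring_def)
  define e where "e b c = b \<otimes>\<^bsub>?H\<^esub> xa \<oplus>\<^bsub>?H\<^esub> (\<Oplus>\<^bsub>?H\<^esub> i\<in>{1..r}. c i \<otimes>\<^bsub>?H\<^esub> G i)" for b c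
  define S where "S = {1..r} \<rightarrow> carrier ?H"
  have eq: "Delta_ideal lam \<xi> r \<alpha> = {e b c |b c. b \<in> carrier ?H \<and> c \<in> S}"
    by (simp add: Delta_ideal_def e_def xa_def G_def S_def)
  have eI: "e b c \<in> Delta_ideal lam \<xi> r \<alpha>" if "b \<in> carrier ?H" "c \<in> S" for b c
    using that unfolding eq by blast
  have closed: "e b c \<in> carrier ?H" if "b \<in> carrier ?H" "c \<in> S" for b c
    using that xa G by (auto simp: e_def S_def intro!: H.finsum_closed)
  have mult: "a \<otimes>\<^bsub>?H\<^esub> e b c = e (a \<otimes>\<^bsub>?H\<^esub> b) (\<lambda>i. a \<otimes>\<^bsub>?H\<^esub> c i)"
    if "a \<in> carrier ?H" "b \<in> carrier ?H" "c \<in> S" for a b c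
  proof -
    have "a \<otimes>\<^bsub>?H\<^esub> (\<Oplus>\<^bsub>?H\<^esub> i\<in>{1..r}. c i \<otimes>\<^bsub>?H\<^esub> G i) = (\<Oplus>\<^bsub>?H\<^esub> i\<in>{1..r}. a \<otimes>\<^bsub>?H\<^esub> (c i \<otimes>\<^bsub>?H\<^esub> G i))"
      using that G by (intro H.finsum_rdistr) (auto simp: S_def Pi_iff)
    also have "\<dots> = (\<Oplus>\<^bsub>?H\<^esub> i\<in>{1..r}. a \<otimes>\<^bsub>?H\<^esub> c i \<otimes>\<^bsub>?H\<^esub> G i)"
      using that G by (intro H.finsum_cong') (simp_all add: S_def Pi_iff H.m_assoc)
    finally show ?thesis
      using that xa G by (simp add: e_def H.r_distr H.m_assoc S_def Pi_iff H.finsum_closed)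
  qed
  have add: "e b c \<oplus>\<^bsub>?H\<^esub> e b' c' = e (b \<oplus>\<^bsub>?H\<^esub> b') (\<lambda>i. c i \<oplus>\<^bsub>?H\<^esub> c' i)"
    if "b \<in> carrier ?H" "c \<in> S" "b' \<in> carrier ?H" "c' \<in> S" for b c b' c'
  proof -
    have "(\<Oplus>\<^bsub>?H\<^esub> i\<in>{1..r}. (c i \<oplus>\<^bsub>?H\<^esub> c' i) \<otimes>\<^bsub>?H\<^esub> G i) =
        (\<Oplus>\<^bsub>?H\<^esub> i\<in>{1..r}. c i \<otimes>\<^bsub>?H\<^esub> G i \<oplus>\<^bsub>?H\<^esub> c' i \<otimes>\<^bsub>?H\<^esub> G i)"
      using that G by (intro H.finsum_cong') (simp_all add: S_def Pi_iff H.l_distr)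
    also have "\<dots> = (\<Oplus>\<^bsub>?H\<^esub> i\<in>{1..r}. c i \<otimes>\<^bsub>?H\<^esub> G i) \<oplus>\<^bsub>?H\<^esub> (\<Oplus>\<^bsub>?H\<^esub> i\<in>{1..r}. c' i \<otimes>\<^bsub>?H\<^esub> G i)"
      using that G by (intro H.finsum_addf) (auto simp: S_def Pi_iff)
    finally show ?thesis
      using that xa G by (simp add: e_def H.l_distr H.a_ac S_def Pi_iff H.finsum_closed)
  qed
  have neg: "\<ominus>\<^bsub>?H\<^esub> y = (\<ominus>\<^bsub>?H\<^esub> \<one>\<^bsub>?H\<^esub>) \<otimes>\<^bsub>?H\<^esub> y" if "y \<in> carrier ?H" for y
    using that by (simp add: H.l_minus)
  have M_simps: "carrier ?M = carrier ?H" "add ?M = add ?H" "zero ?M = zero ?H" "Module.smult ?M = mult ?H"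
    by (simp_all add: regular_module_def)
  have inv: "inv\<^bsub>add_monoid ?M\<^esub> y = \<ominus>\<^bsub>?H\<^esub> y" for y
    by (simp add: a_inv_def m_inv_def M_simps)
  have Smult: "(\<lambda>i. a \<otimes>\<^bsub>?H\<^esub> c i) \<in> S" if "a \<in> carrier ?H" "c \<in> S" for a c
    using that by (auto simp: S_def)
  have Sadd: "(\<lambda>i. c i \<oplus>\<^bsub>?H\<^esub> c' i) \<in> S" if "c \<in> S" "c' \<in> S" for c c'
    using that by (auto simp: S_def Pi_iff)
  show ?thesis
  proof (intro Module.submodule.intro Module.submodule_axioms.intro subgroup.intro)
    show "Delta_ideal lam \<xi> r \<alpha> \<subseteq> carrier (add_monoid ?M)"
      by (auto simp: eq M_simps closed)
    show "\<one>\<^bsub>add_monoid ?M\<^esub> \<in> Delta_ideal lam \<xi> r \<alpha>"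
    proof -
      have S0: "(\<lambda>i. \<one>\<^bsub>?H\<^esub>) \<in> S" by (auto simp: S_def)
      have "\<zero>\<^bsub>?H\<^esub> = \<zero>\<^bsub>?H\<^esub> \<otimes>\<^bsub>?H\<^esub> e \<one>\<^bsub>?H\<^esub> (\<lambda>i. \<one>\<^bsub>?H\<^esub>)"
        using closed[OF _ S0] by simp
      then show ?thesis
        using mult[OF H.zero_closed H.one_closed S0]
          eI[OF H.zero_closed Smult[OF H.zero_closed S0]]
        by (simp add: M_simps)
    qed
    fix y assume y: "y \<in> Delta_ideal lam \<xi> r \<alpha>"
    then obtain b c where bc: "y = e b c" "b \<in> carrier ?H" "c \<in> S" by (auto simp: eq)
    show ay: "a \<odot>\<^bsub>?M\<^esub> y \<in> Delta_ideal lam \<xi> r \<alpha>" if "a \<in> carrier ?H" for a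
      using that bc by (simp add: M_simps mult eI Smult)
    show "inv\<^bsub>add_monoid ?M\<^esub> y \<in> Delta_ideal lam \<xi> r \<alpha>"
      using ay[of "\<ominus>\<^bsub>?H\<^esub> \<one>\<^bsub>?H\<^esub>"] neg[of y] closed bc unfolding inv by (simp add: M_simps)
    fix z assume "z \<in> Delta_ideal lam \<xi> r \<alpha>"
    then obtain b' c' where "z = e b' c'" "b' \<in> carrier ?H" "c' \<in> S" by (auto simp: eq)
    then show "y \<otimes>\<^bsub>add_monoid ?M\<^esub> z \<in> Delta_ideal lam \<xi> r \<alpha>"
      using bc by (simp add: M_simps add eI Sadd)
  qed
qed

lemma left_module_Delta: "left_module (H_alg lam) (Delta lam \<xi> r \<alpha>)"
  unfolding Delta_def
  by (rule left_module.left_module_quotient_module[OF left_module_regular_module[OF ring_H_alg]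
        submodule_Delta_ideal])


section \<open>Dimensions over the algebraic closure\<close>

text \<open>Restriction of scalars along \<open>k \<rightarrow> H\<^sub>\<lambda>\<close>, for \<open>k\<close> the algebraic closure.\<close>

definition k_space ::
    "'f::field group_alg \<Rightarrow> ('f smash set, 'v) module \<Rightarrow> ('f alg_closure, 'v) module" where
  "k_space lam V = \<lparr>carrier = carrier V, mult = mult V, one = one V, zero = zero V, add = add V,
     smult = (\<lambda>c v. H_class lam (of_free (fconst c)) \<odot>\<^bsub>V\<^esub> v)\<rparr>"

lemma vectorspace_k_space:
  fixes lam :: "'f::field group_alg"
  assumes "left_module (H_alg lam) V"
  shows "vectorspace (ring_of_type_algebra :: 'f alg_closure ring) (k_space lam V)"
proof -
  let ?k = "ring_of_type_algebra :: 'f alg_closure ring"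
  interpret V: left_module "H_alg lam" V by fact
  interpret k: field ?k by (rule field_from_type_algebra)
  have k_simps: "carrier ?k = UNIV" "add ?k = (+)" "mult ?k = (*)" "one ?k = 1"
    by (simp_all add: ring_of_type_algebra_def fun_eq_iff)
  note hom = H_class_hom[of lam]
  have closed: "H_class lam P \<in> carrier (H_alg lam)" for P
    using hom by (auto simp: ring_hom_def smash_ring_def)
  have hom_add: "H_class lam (P + Q) = H_class lam P \<oplus>\<^bsub>H_alg lam\<^esub> H_class lam Q" for P Q
    using ring_hom_add[OF hom] by (simp add: smash_ring_def)
  have hom_mult: "H_class lam (smash_mult P Q) = H_class lam P \<otimes>\<^bsub>H_alg lam\<^esub> H_class lam Q" for P Q
    using ring_hom_mult[OF hom] by (simp add: smash_ring_def)
  have hom_one: "H_class lam (Poly_Mapping.single 0 1) = \<one>\<^bsub>H_alg lam\<^esub>"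
    using ring_hom_one[OF hom] by (simp add: smash_ring_def)
  have fc: "of_free (fconst (a + b)) = of_free (fconst a) + of_free (fconst b)"
    "of_free (fconst (a * b)) = smash_mult (of_free (fconst a)) (of_free (fconst b))"
    "of_free (fconst 1) = Poly_Mapping.single 0 1" for a b :: "'f alg_closure"
    by (simp_all add: of_free_def single_add del: single_one)
  have "abelian_group (k_space lam V)"
  proof (rule abelian_groupI)
    fix x assume "x \<in> carrier (k_space lam V)"
    then show "\<exists>y\<in>carrier (k_space lam V). y \<oplus>\<^bsub>k_space lam V\<^esub> x = \<zero>\<^bsub>k_space lam V\<^esub>"
      by (intro bexI[of _ "\<ominus>\<^bsub>V\<^esub> x"]) (simp_all add: k_space_def V.l_neg)
  qed (simp_all add: k_space_def V.a_ac)
  then show ?thesis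
    by (intro vectorspace.intro module.intro module_axioms.intro k.is_cring k.field_axioms)
      (simp_all del: fconst_simps single_one add: k_space_def k_simps fc hom_add hom_mult hom_one closed V.smult_closed
        V.smult_l_distr V.smult_r_distr V.smult_assoc V.smult_one)
qed

text \<open>
  \<^const>\<open>vectorspace.dim\<close> is meaningful only for finite-dimensional spaces, hence the first conjunct.
\<close>

definition has_k_dim :: "'f::field group_alg \<Rightarrow> ('f smash set, 'v) module \<Rightarrow> nat \<Rightarrow> bool" where
  "has_k_dim lam V n \<longleftrightarrow>
     vectorspace.fin_dim (ring_of_type_algebra :: 'f alg_closure ring) (k_space lam V) \<and>
     vectorspace.dim (ring_of_type_algebra :: 'f alg_closure ring) (k_space lam V) = n"

end

theory Submission
  imports Defs "HOL-Algebra.Exponent" "HOL-Number_Theory.Residues" "Jordan_Normal_Form.Determinant"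
    "Jordan_Normal_Form.VS_Connect"
begin

hide_const (open) Polynomial.smult Divisibility.prime

text \<open>
  A simple quotient \<open>V\<close> of \<open>\<Delta>\<^sub>\<alpha>\<close> is generated by a vector \<open>v\<close> with \<open>x v = \<alpha> v\<close> and \<open>g v = v\<close> for
  \<open>g \<in> E\<close>, so \<open>V = k[y] v\<close>. The commutator with \<open>y\<close> is a derivation \<open>\<delta>\<close> of the commutative algebra
  \<open>A = k[x] E\<close>, with \<open>\<delta> x = \<lambda>\<close> and \<open>\<delta> g\<^sub>a = a x g\<^sub>a\<close>. If \<open>\<tau> : A \<rightarrow> k\<close> is the character by which \<open>A\<close>
  acts on \<open>v\<close> and \<open>T\<^sub>i = \<tau> \<delta>\<^sup>i\<close>, then \<open>a y\<^sup>n v = (\<Sum>\<^sub>i (n choose i) T\<^sub>i(a) y\<^sup>n\<^sup>-\<^sup>i) v\<close>. Hence \<open>V\<close> is \<open>k[y]\<close>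
  modulo a maximal proper ideal stable under these operators.

  Let \<open>s\<close> be least such that the functional \<open>T\<^sub>m\<close> with \<open>m = p\<^sup>s\<close> depends linearly on the earlier
  \<open>T\<close>'s with exponent a power of \<open>p\<close>. The relation gives a \<open>p\<close>-polynomial \<open>f\<close> of degree \<open>p\<^sup>s\<close> with
  \<open>f(y)\<close> an endomorphism of \<open>V\<close>, so \<open>f - c\<close> lies in the ideal for some \<open>c\<close>; independence of
  the \<open>T\<^sub>i\<close> with \<open>i < p\<^sup>s\<close> shows that the ideal contains nothing of smaller degree. Thus
  \<open>dim V = p\<^sup>s\<close>.

  It remains to find \<open>s\<close>. For \<open>\<alpha> = 0\<close> everything in degree \<open>1\<close> vanishes except \<open>T\<^sub>1(x) = \<epsilon>(\<lambda>)\<close>, and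
  \<open>T\<^sub>p(g) = 0\<close> because \<open>\<delta>\<close> changes the parity of the \<open>x\<close>-degree. For \<open>\<alpha> \<noteq> 0\<close>, \<open>T\<^sub>n(g\<^sub>a)\<close> is a polynomial
  of degree \<open>n\<close> in \<open>a \<in> \<bbbF>\<^sub>q\<close>, which gives independence for \<open>n = 1, p, \<dots>, p\<^sup>r\<^sup>-\<^sup>1\<close>. For \<open>n = q\<close> it
  has to be reduced modulo \<open>a\<^sup>q - a\<close>, and comparing the linear coefficient with the values on
  \<open>x\<^sup>2 - 2 \<mu>\<close>, where \<open>\<mu> = \<Sum> (c\<^sub>a / a) g\<^sub>a\<close> and \<open>\<delta> (x\<^sup>2 - 2 \<mu>) = 2 c\<^sub>0 x\<close>, separates \<open>t = 0\<close> from \<open>t = 1\<close>.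
\<close>

section \<open>Derivations at a point in prime characteristic\<close>

lemma fold_coeffs_pCons':
  assumes "f 0 z = z"
  shows "fold_coeffs f (pCons a p) z = f a (fold_coeffs f p z)"
  using assms by (cases "p = 0"; cases "a = 0") auto

text \<open>In characteristic p the freshman's dream turns (X + 1)^N with N = p^j into X^N + 1, and
  the coefficients of this power are the binomials.\<close>

lemma of_nat_prime_power_choose_eq_0:
  assumes "prime CHAR('k::field)" "0 < i" "i < CHAR('k) ^ j"
  shows "of_nat (CHAR('k) ^ j choose i) = (0 :: 'k)"
proof -
  let ?N = "CHAR('k) ^ j"
  have char: "CHAR('k poly) = CHAR('k)"
    by simp
  have "[:0, 1:] + (1 :: 'k poly) = [:1, 1:]"
    by (simp add: one_pCons)
  then have "[:1, 1 :: 'k:] ^ ?N = monom 1 ?N + 1"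
    using freshmans_dream'[where ?'a = "'k poly", of ?N j "[:0, 1:]" 1] assms(1)
    by (simp add: char monom_altdef)
  then have "coeff ([:1, 1 :: 'k:] ^ ?N) i = 0"
    using assms by simp
  then show ?thesis
    using assms by (simp add: coeff_linear_poly_power)
qed

text \<open>Write N = p^e m with m prime to p. Then the binomial of N over p^e is prime to p (the
  count behind Sylow's theorem), so p^e is not an inner index and must equal N.\<close>

lemma prime_power_if_choose_eq_0:
  assumes p: "prime CHAR('k::field)" and "N > 0"
    and "\<And>l. 0 < l \<Longrightarrow> l < N \<Longrightarrow> of_nat (N choose l) = (0 :: 'k)"
  obtains e where "N = CHAR('k) ^ e"
proof -
  let ?p = "CHAR('k)"
  define e where "e = multiplicity ?p N"
  obtain m where m: "N = ?p ^ e * m" "\<not> ?p dvd m"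
    using multiplicity_decompose'[of N ?p] assms(2) p
    by (metis e_def not_prime_unit not_gr0)
  then have "m > 0" using assms(2) by (cases m) auto
  have "multiplicity ?p (N choose ?p ^ e) = 0"
    using const_p_fac[OF \<open>m > 0\<close> p, of e] m not_dvd_imp_multiplicity_0 by metis
  moreover have "?p ^ e \<le> N"
    using m \<open>m > 0\<close> by simp
  ultimately have "\<not> ?p dvd (N choose ?p ^ e)"
    using p by (metis binomial_eq_0_iff multiplicity_eq_zero_iff not_less not_prime_unit)
  then have "of_nat (N choose ?p ^ e) \<noteq> (0 :: 'k)"
    by (simp add: of_nat_eq_0_iff_char_dvd)
  moreover have "?p ^ e > 0"
    using p by (simp add: prime_gt_0_nat)
  ultimately have "N = ?p ^ e"
    using assms(3)[of "?p ^ e"] \<open>?p ^ e \<le> N\<close> by (cases "?p ^ e < N") auto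
  then show ?thesis by (rule that)
qed

text \<open>Pascal's rule with two indices, the induction step shared by \<open>T_mult\<close> and
  \<open>L_monom_mult\<close>.\<close>

lemma binomial_sum_Suc:
  fixes f :: "nat \<Rightarrow> nat \<Rightarrow> 'b::comm_ring_1"
  shows "(\<Sum>i\<le>n. of_nat (n choose i) * (f (Suc i) (n - i) + f i (Suc (n - i)))) =
    (\<Sum>i\<le>Suc n. of_nat (Suc n choose i) * f i (Suc n - i))"
proof -
  let ?c = "\<lambda>i. if i = 0 then 0 else n choose (i - 1)"
  have "(\<Sum>i\<le>n. of_nat (n choose i) * (f (Suc i) (n - i) + f i (Suc (n - i)))) =
      (\<Sum>i\<le>n. of_nat (n choose i) * f (Suc i) (n - i)) + (\<Sum>i\<le>n. of_nat (n choose i) * f i (Suc (n - i)))"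
    by (simp only: distrib_left sum.distrib)
  also have "(\<Sum>i\<le>n. of_nat (n choose i) * f (Suc i) (n - i)) = (\<Sum>i\<le>Suc n. of_nat (?c i) * f i (Suc n - i))"
    by (subst sum.atMost_Suc_shift) simp
  also have "(\<Sum>i\<le>n. of_nat (n choose i) * f i (Suc (n - i))) =
      (\<Sum>i\<le>Suc n. of_nat (n choose i) * f i (Suc n - i))"
    by (simp add: Suc_diff_le binomial_eq_0)
  also have "(\<Sum>i\<le>Suc n. of_nat (?c i) * f i (Suc n - i)) + \<dots> =
      (\<Sum>i\<le>Suc n. of_nat (Suc n choose i) * f i (Suc n - i))"
    unfolding sum.distrib[symmetric]
  proof (intro sum.cong refl)
    fix i assume "i \<in> {..Suc n}"
    show "of_nat (?c i) * f i (Suc n - i) + of_nat (n choose i) * f i (Suc n - i) =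
        of_nat (Suc n choose i) * f i (Suc n - i)"
      by (cases i) (simp_all add: algebra_simps)
  qed
  finally show ?thesis .
qed

section \<open>Functionals obtained by iterating a derivation at a point, and their action on
  k[y]\<close>

locale derivation_at_point =
  fixes delta :: "'a::comm_ring_1 \<Rightarrow> 'a" and tau :: "'a \<Rightarrow> 'k::alg_closed_field"
    and const :: "'k \<Rightarrow> 'a"
  assumes delta_add: "delta (a + b) = delta a + delta b"
    and delta_mult: "delta (a * b) = delta a * b + a * delta b"
    and tau_add: "tau (a + b) = tau a + tau b"
    and tau_mult: "tau (a * b) = tau a * tau b"
    and tau_const: "tau (const c) = c"
    and delta_const: "delta (const c) = 0"
    and const_1: "const 1 = 1"
begin

definition T :: "nat \<Rightarrow> 'a \<Rightarrow> 'k" where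
  "T n a = tau ((delta ^^ n) a)"

lemma tau_0 [simp]: "tau 0 = 0" and delta_0 [simp]: "delta 0 = 0"
  using tau_add[of 0 0] delta_add[of 0 0] by (metis add_0_left add_right_cancel)+

lemma tau_1 [simp]: "tau 1 = 1"
  using tau_const[of 1] by (simp add: const_1)

lemma delta_1 [simp]: "delta 1 = 0"
  using delta_const[of 1] by (simp add: const_1)

lemma tau_diff: "tau (a - b) = tau a - tau b"
  using tau_add[of "a - b" b] by (simp add: algebra_simps)

lemma tau_sum: "tau (sum f B) = (\<Sum>i\<in>B. tau (f i))"
  by (induction B rule: infinite_finite_induct) (simp_all add: tau_add)

lemma funpow_delta_0 [simp]: "(delta ^^ n) 0 = 0"
  by (induction n) simp_all

lemma funpow_delta_add: "(delta ^^ n) (a + b) = (delta ^^ n) a + (delta ^^ n) b"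
  by (induction n) (simp_all add: delta_add)

lemma funpow_delta_sum: "(delta ^^ n) (sum f B) = (\<Sum>i\<in>B. (delta ^^ n) (f i))"
  by (induction B rule: infinite_finite_induct) (simp_all add: funpow_delta_add)

lemma delta_const_mult: "(delta ^^ n) (const c * a) = const c * (delta ^^ n) a"
  by (induction n) (simp_all add: delta_mult delta_const)

lemma T_0 [simp]: "T 0 = tau"
  by (simp add: T_def fun_eq_iff)

lemma T_zero [simp]: "T n 0 = 0"
  by (simp add: T_def)

lemma T_Suc: "T (Suc n) a = T n (delta a)"
  by (simp only: T_def funpow_Suc_right comp_def)

lemma T_funpow: "T m ((delta ^^ n) a) = T (m + n) a"
  by (simp add: T_def funpow_add)

lemma T_add: "T n (a + b) = T n a + T n b"
  by (simp add: T_def funpow_delta_add tau_add)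

lemma T_sum: "T n (sum f B) = (\<Sum>i\<in>B. T n (f i))"
  by (simp add: T_def funpow_delta_sum tau_sum)

lemma T_diff: "T n (a - b) = T n a - T n b"
  using T_add[of n "a - b" b] by simp

lemma T_const_mult: "T n (const c * a) = c * T n a"
  by (simp add: T_def delta_const_mult tau_mult tau_const)

lemma T_const: "n > 0 \<Longrightarrow> T n (const c) = 0"
  by (cases n) (simp_all add: T_Suc delta_const)

lemma T_mult: "T n (a * b) = (\<Sum>i\<le>n. of_nat (n choose i) * T i a * T (n - i) b)"
proof (induction n arbitrary: a b)
  case 0
  show ?case by (simp add: tau_mult)
next
  case (Suc n)
  let ?F = "\<lambda>i j. T i a * T j b"
  have "T (Suc n) (a * b) = (\<Sum>i\<le>n. of_nat (n choose i) * (?F (Suc i) (n - i) + ?F i (Suc (n - i))))"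
    by (simp add: T_Suc delta_mult T_add Suc mult.assoc distrib_left sum.distrib)
  also have "\<dots> = (\<Sum>i\<le>Suc n. of_nat (Suc n choose i) * ?F i (Suc n - i))"
    by (rule binomial_sum_Suc)
  finally show ?case by (simp only: mult.assoc)
qed

text \<open>The inner binomials of the Leibniz rule vanish, so the functional is again a derivation
  at the point.\<close>

lemma T_power_char_mult:
  assumes "prime CHAR('k)"
  shows "T (CHAR('k) ^ j) (a * b) = tau a * T (CHAR('k) ^ j) b + T (CHAR('k) ^ j) a * tau b"
proof -
  let ?N = "CHAR('k) ^ j"
  have N: "?N > 0" using assms by (simp add: prime_gt_0_nat)
  have "T ?N (a * b) = (\<Sum>i\<in>{0, ?N}. of_nat (?N choose i) * T i a * T (?N - i) b)"
    unfolding T_mult using assms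
    by (intro sum.mono_neutral_right) (auto simp: of_nat_prime_power_choose_eq_0)
  then show ?thesis using N by simp
qed

text \<open>
  A shortest linear relation \<open>\<Sum>\<kappa>\<^sub>i T\<^sub>i = 0\<close>, evaluated on products by the Leibniz rule, forces
  \<open>\<kappa>\<^sub>i = 0\<close> unless all inner binomial coefficients of \<open>i\<close> vanish, i.e. unless \<open>i\<close> is a power of
  the characteristic.
\<close>
lemma T_independent:
  assumes p: "prime CHAR('k)"
    and indep: "\<And>b. (\<And>a. (\<Sum>j<s. b j * T (CHAR('k) ^ j) a) = 0) \<Longrightarrow> \<forall>j<s. b j = 0"
    and rel: "\<And>a. (\<Sum>i\<in>{1..N}. \<kappa> i * T i a) = 0" and N: "N < CHAR('k) ^ s"
  shows "\<forall>i\<in>{1..N}. \<kappa> i = 0"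
  using rel N
proof (induction N arbitrary: \<kappa>)
  case 0
  then show ?case by simp
next
  case (Suc N)
  have N_less: "N < CHAR('k) ^ s" using Suc.prems(2) by simp
  have nz: "\<kappa> i = 0" if i: "i \<in> {1..Suc N}" and l: "0 < l" "l < i" and c: "of_nat (i choose l) \<noteq> (0::'k)" for i l
  proof -
    \<comment> \<open>\<open>\<mu> b l\<close> collects the factor of \<open>T l a\<close> when the
      relation is evaluated at \<open>a * b\<close>. For \<open>tau b = 0\<close> the terms with l =
      i vanish, those with l = 0 cancel by the relation at \<open>b\<close>, and a shorter relation
      remains.\<close>
    define \<mu> where "\<mu> b l = (\<Sum>i\<in>{Suc l..Suc N}. \<kappa> i * of_nat (i choose l) * T (i - l) b)" for b l
    have mu0: "\<mu> b l = 0" if b: "tau b = 0" and l: "l \<in> {1..N}" for b l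
    proof -
      have "(\<Sum>l\<in>{1..N}. \<mu> b l * T l a) = 0" for a
      proof -
        let ?f = "\<lambda>i l. \<kappa> i * (of_nat (i choose l) * T l a * T (i - l) b)"
        have "0 = (\<Sum>i\<in>{1..Suc N}. \<kappa> i * T i (a * b))"
          by (simp only: Suc.prems(1))
        also have "\<dots> = (\<Sum>i\<in>{1..Suc N}. \<kappa> i * T i b * tau a + (\<Sum>l\<in>{1..<i}. ?f i l))"
        proof (intro sum.cong refl)
          fix i assume i: "i \<in> {1..Suc N}"
          have "{..i} = insert 0 (insert i {1..<i})" using i by auto
          then have "(\<Sum>l\<le>i. of_nat (i choose l) * T l a * T (i - l) b) =
              T i b * tau a + (\<Sum>l\<in>{1..<i}. of_nat (i choose l) * T l a * T (i - l) b)"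
            using i b by simp
          then show "\<kappa> i * T i (a * b) = \<kappa> i * T i b * tau a + (\<Sum>l\<in>{1..<i}. ?f i l)"
            by (simp add: T_mult sum_distrib_left distrib_left mult_ac)
        qed
        also have "\<dots> = (\<Sum>i\<in>{1..Suc N}. \<kappa> i * T i b) * tau a + (\<Sum>i\<in>{1..Suc N}. \<Sum>l\<in>{1..<i}. ?f i l)"
          by (simp only: sum.distrib sum_distrib_right)
        also have "\<dots> = (\<Sum>i\<in>{1..Suc N}. \<Sum>l | l \<in> {1..N} \<and> l < i. ?f i l)"
        proof -
          have "{1..<i} = {l. l \<in> {1..N} \<and> l < i}" if "i \<in> {1..Suc N}" for i
            using that by auto
          then show ?thesis
            by (simp only: Suc.prems(1) mult_zero_left add_0_left cong: sum.cong)
        qed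
        also have "\<dots> = (\<Sum>l\<in>{1..N}. \<Sum>i | i \<in> {1..Suc N} \<and> l < i. ?f i l)"
          by (rule sum.swap_restrict) simp_all
        also have "\<dots> = (\<Sum>l\<in>{1..N}. \<mu> b l * T l a)"
          unfolding \<mu>_def sum_distrib_right
          by (intro sum.cong refl) (auto simp: mult_ac)
        finally show ?thesis by simp
      qed
      then have "\<forall>l\<in>{1..N}. \<mu> b l = 0" using N_less by (rule Suc.IH)
      then show ?thesis using l by blast
    qed
    have lN: "l \<in> {1..N}" using i l by auto
    let ?c = "\<lambda>j. \<kappa> (j + l) * of_nat ((j + l) choose l)"
    have rel: "(\<Sum>j\<in>{1..Suc N - l}. ?c j * T j b) = 0" for b
    proof -
      \<comment> \<open>Subtracting a constant makes \<open>tau\<close> vanish without changing any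
        \<open>T j\<close> with j > 0.\<close>
      define b' where "b' = b - const (tau b)"
      have "T j b = T j b'" if "j \<in> {1..Suc N - l}" for j
        using that by (simp add: b'_def T_diff T_const)
      then have "(\<Sum>j\<in>{1..Suc N - l}. ?c j * T j b) = (\<Sum>j\<in>{1..Suc N - l}. ?c j * T j b')"
        by (intro sum.cong refl) simp
      also have "\<dots> = \<mu> b' l"
        unfolding \<mu>_def
        by (rule sum.reindex_bij_witness[of _ "\<lambda>i. i - l" "\<lambda>j. j + l"]) auto
      also have "\<dots> = 0" using lN by (intro mu0) (simp_all add: b'_def tau_diff tau_const)
      finally show ?thesis .
    qed
    \<comment> \<open>The new relation has length \<open>Suc N - l\<close>, at most
      \<open>N\<close>; padding with zeros makes the induction hypothesis applicable.\<close>
    define d where "d j = (if j \<le> Suc N - l then ?c j else 0)" for j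
    have "(\<Sum>j\<in>{1..N}. d j * T j b) = (\<Sum>j\<in>{1..Suc N - l}. ?c j * T j b)" for b
      using l unfolding d_def by (intro sum.mono_neutral_cong_right) auto
    then have "(\<Sum>j\<in>{1..N}. d j * T j b) = 0" for b
      by (simp only: rel)
    then have "\<forall>j\<in>{1..N}. d j = 0" using N_less by (rule Suc.IH)
    moreover have "i - l \<in> {1..N}" using i l by auto
    ultimately have "d (i - l) = 0" by blast
    then have "?c (i - l) = 0" using i l by (simp add: d_def split: if_splits)
    then show ?thesis using c l by simp
  qed
  \<comment> \<open>What survives is supported on powers of the characteristic, hence is a relation
    of the kind excluded by \<open>indep\<close>.\<close>
  define b where "b j = (if CHAR('k) ^ j \<le> Suc N then \<kappa> (CHAR('k) ^ j) else 0)" for j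
  have p1: "CHAR('k) > 1" using p by (rule prime_gt_1_nat)
  have pow: "\<exists>j<s. i = CHAR('k) ^ j" if "i \<in> {1..Suc N}" "\<kappa> i \<noteq> 0" for i
  proof -
    have "of_nat (i choose l) = (0 :: 'k)" if "0 < l" "l < i" for l
      using nz[of i l] that \<open>i \<in> {1..Suc N}\<close> \<open>\<kappa> i \<noteq> 0\<close> by blast
    then obtain j where j: "i = CHAR('k) ^ j"
      using prime_power_if_choose_eq_0[OF p, of i] \<open>i \<in> {1..Suc N}\<close> by auto
    then have "CHAR('k) ^ j < CHAR('k) ^ s" using that Suc.prems(2) by simp
    then show ?thesis using j p1 by auto
  qed
  have "(\<Sum>j<s. b j * T (CHAR('k) ^ j) a) = 0" for a
  proof -
    have inj: "inj_on ((^) CHAR('k)) {..<s}" using p1 by (auto simp: inj_on_def)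
    have "(\<Sum>j<s. b j * T (CHAR('k) ^ j) a) =
        (\<Sum>i\<in>(^) CHAR('k) ` {..<s}. (if i \<le> Suc N then \<kappa> i else 0) * T i a)"
      by (simp add: sum.reindex[OF inj] b_def)
    also have "\<dots> = (\<Sum>i\<in>{1..Suc N}. \<kappa> i * T i a)"
    proof (rule sum.mono_neutral_cong)
      fix i assume "i \<in> {1..Suc N} - (^) CHAR('k) ` {..<s}"
      then have "\<kappa> i = 0" using pow[of i] by blast
      then show "\<kappa> i * T i a = 0" by simp
    next
      fix i assume "i \<in> (^) CHAR('k) ` {..<s} - {1..Suc N}"
      then have "\<not> i \<le> Suc N" using p1 by (auto simp: Suc_le_eq)
      then show "(if i \<le> Suc N then \<kappa> i else 0) * T i a = 0" by simp
    qed simp_all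
    finally show ?thesis by (simp only: Suc.prems(1))
  qed
  then have b0: "\<forall>j<s. b j = 0" by (rule indep)
  show ?case
  proof (intro ballI, rule ccontr)
    fix i assume i: "i \<in> {1..Suc N}" and ki: "\<kappa> i \<noteq> 0"
    then obtain j where "j < s" "i = CHAR('k) ^ j" using pow by blast
    then show False using b0 i ki by (auto simp: b_def)
  qed
qed

text \<open>In a module with \<open>a y = y a + delta a\<close> and \<open>a v = tau a v\<close>,
  the vector \<open>a m(y) v\<close> equals \<open>(L m a)(y) v\<close>; the recursion moves
  \<open>a\<close> past one y at a time. The fold yields functions of \<open>a\<close>, since
  \<open>a\<close> turns into \<open>delta a\<close> on the way.\<close>

definition L :: "'k poly \<Rightarrow> 'a \<Rightarrow> 'k poly" where
  "L m = fold_coeffs (\<lambda>c F a. pCons (c * tau a) (F a) + F (delta a)) m (\<lambda>_. 0)"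

lemma L_0 [simp]: "L 0 a = 0"
  by (simp add: L_def)

lemma L_pCons [simp]: "L (pCons c m) a = pCons (c * tau a) (L m a) + L m (delta a)"
  unfolding L_def by (subst fold_coeffs_pCons') (simp_all add: fun_eq_iff)

lemma L_add: "L (m + n) a = L m a + L n a"
  by (induction m n arbitrary: a rule: poly_induct2) (simp_all add: algebra_simps)

lemma L_smult: "L (Polynomial.smult c m) a = Polynomial.smult c (L m a)"
  by (induction m arbitrary: a) (simp_all add: smult_add_right mult.assoc)

lemma L_sum: "L (sum f B) a = (\<Sum>i\<in>B. L (f i) a)"
  by (induction B rule: infinite_finite_induct) (simp_all add: L_add)

lemma L_arg_0 [simp]: "L m 0 = 0"
  by (induction m) simp_all

lemma L_arg_add: "L m (a + b) = L m a + L m b"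
  by (induction m arbitrary: a b) (simp_all add: tau_add delta_add algebra_simps)

lemma L_arg_sum: "L m (sum f B) = (\<Sum>i\<in>B. L m (f i))"
  by (induction B rule: infinite_finite_induct) (simp_all add: L_arg_add)

lemma L_arg_const_mult: "L m (const c * a) = Polynomial.smult c (L m a)"
  by (induction m arbitrary: a)
    (simp_all add: tau_mult tau_const delta_mult delta_const smult_add_right mult.left_commute[of _ c])

text \<open>Every step of the recursion either applies \<open>tau\<close> or differentiates, so
  \<open>L m a\<close> depends on \<open>a\<close> only through the values
  \<open>T i a\<close>.\<close>

lemma L_arg_eq_0:
  assumes "\<And>i. T i a = 0"
  shows "L m a = 0"
  using assms
proof (induction m arbitrary: a)
  case (pCons c m)
  have "T i (delta a) = 0" for i
    using pCons.prems[of "Suc i"] by (simp only: T_Suc)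
  moreover have "tau a = 0" using pCons.prems[of 0] by simp
  ultimately show ?case using pCons by simp
qed simp

lemma L_monom_mult:
  "L (monom 1 n * m) a = (\<Sum>i\<le>n. of_nat (n choose i) * (L m ((delta ^^ i) a) * monom 1 (n - i)))"
proof (induction n arbitrary: a)
  case 0
  show ?case by (simp flip: one_pCons add: monom_0)
next
  case (Suc n)
  let ?f = "\<lambda>i j. L m ((delta ^^ i) a) * monom 1 j"
  have "L (monom 1 (Suc n) * m) a = pCons 0 (L (monom 1 n * m) a) + L (monom 1 n * m) (delta a)"
    by (simp add: monom_Suc)
  also have "L (monom 1 n * m) (delta a) = (\<Sum>i\<le>n. of_nat (n choose i) * ?f (Suc i) (n - i))"
    by (simp only: Suc funpow_Suc_right comp_def)
  also have "pCons 0 (L (monom 1 n * m) a) = (\<Sum>i\<le>n. of_nat (n choose i) * ?f i (Suc (n - i)))"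
  proof -
    have "pCons 0 P = P * monom 1 1" for P :: "'k poly"
      by (simp add: monom_altdef)
    then show ?thesis
      by (simp add: Suc sum_distrib_right mult.assoc mult_monom)
  qed
  also have "\<dots> + (\<Sum>i\<le>n. of_nat (n choose i) * ?f (Suc i) (n - i)) =
      (\<Sum>i\<le>n. of_nat (n choose i) * (?f (Suc i) (n - i) + ?f i (Suc (n - i))))"
    by (simp only: distrib_left sum.distrib add.commute)
  also have "\<dots> = (\<Sum>i\<le>Suc n. of_nat (Suc n choose i) * ?f i (Suc n - i))"
    by (rule binomial_sum_Suc)
  finally show ?case .
qed

text \<open>The middle terms of \<open>L_monom_mult\<close> carry binomials divisible by p, so
  passing y^N with N = p^j leaves a single correction term.\<close>

lemma L_monom_power_char_mult:
  assumes "prime CHAR('k)"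
  shows "L (monom 1 (CHAR('k) ^ j) * m) a =
    monom 1 (CHAR('k) ^ j) * L m a + L m ((delta ^^ (CHAR('k) ^ j)) a)"
proof -
  let ?N = "CHAR('k) ^ j"
  have N: "?N > 0" using assms by (simp add: prime_gt_0_nat)
  have "L (monom 1 ?N * m) a =
      (\<Sum>i\<in>{0, ?N}. of_nat (?N choose i) * (L m ((delta ^^ i) a) * monom 1 (?N - i)))"
    unfolding L_monom_mult using assms
    by (intro sum.mono_neutral_right) (auto simp: of_nat_prime_power_choose_eq_0 of_nat_poly)
  then show ?thesis using N by (simp add: mult.commute flip: one_pCons)
qed

definition ppoly :: "nat \<Rightarrow> (nat \<Rightarrow> 'k) \<Rightarrow> 'k poly" where
  "ppoly s b = (\<Sum>j\<le>s. Polynomial.smult (b j) (monom 1 (CHAR('k) ^ j)))"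

text \<open>The correction terms add up to \<open>L m ?D\<close>. Since \<open>T i ?D\<close> is the
  relation evaluated at \<open>(delta ^^ i) a\<close>, all these values vanish and so does the
  correction.\<close>

lemma L_ppoly_mult:
  assumes p: "prime CHAR('k)" and rel: "\<And>a. (\<Sum>j\<le>s. b j * T (CHAR('k) ^ j) a) = 0"
  shows "L (ppoly s b * m) a = ppoly s b * L m a"
proof -
  let ?D = "\<Sum>j\<le>s. const (b j) * (delta ^^ (CHAR('k) ^ j)) a"
  have "T i ?D = 0" for i
  proof -
    have "T i ?D = (\<Sum>j\<le>s. b j * T (CHAR('k) ^ j) ((delta ^^ i) a))"
      by (simp add: T_sum T_const_mult T_funpow add.commute)
    then show ?thesis by (simp only: rel)
  qed
  then have D: "L m ?D = 0" by (rule L_arg_eq_0)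
  have "L (ppoly s b * m) a =
      (\<Sum>j\<le>s. Polynomial.smult (b j) (monom 1 (CHAR('k) ^ j) * L m a)) + L m ?D"
    by (simp add: ppoly_def sum_distrib_right L_sum L_smult L_monom_power_char_mult[OF p]
        L_arg_sum L_arg_const_mult smult_add_right sum.distrib)
  then show ?thesis by (simp only: D) (simp add: ppoly_def sum_distrib_right)
qed

lemma degree_ppoly:
  assumes p: "prime CHAR('k)" and "b s \<noteq> 0"
  shows "degree (ppoly s b) = CHAR('k) ^ s"
proof -
  have p1: "CHAR('k) > 1" using p by (rule prime_gt_1_nat)
  have "coeff (ppoly s b) (CHAR('k) ^ s) = b s"
  proof -
    have "coeff (ppoly s b) (CHAR('k) ^ s) = (\<Sum>j\<le>s. if j = s then b s else 0)"
      unfolding ppoly_def coeff_sum using p1 by (intro sum.cong) auto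
    then show ?thesis by simp
  qed
  moreover have "degree (ppoly s b) \<le> CHAR('k) ^ s"
    unfolding ppoly_def using p1
    by (intro degree_sum_le) (auto intro!: order.trans[OF degree_smult_le] order.trans[OF degree_monom_le] power_increasing)
  ultimately show ?thesis using assms(2) le_degree[of "ppoly s b" "CHAR('k) ^ s"] by simp
qed

lemma coeff_L_0:
  assumes "degree m < N"
  shows "coeff (L m a) 0 = (\<Sum>i<N. coeff m i * T i a)"
  using assms
proof (induction m arbitrary: N a)
  case (pCons c m)
  then obtain N' where N: "N = Suc N'" by (cases N) auto
  show ?case
  proof (cases "m = 0")
    case True
    then show ?thesis
      by (simp add: N sum.lessThan_Suc_shift mult.commute del: sum.lessThan_Suc)
  next
    case False
    then have "degree m < N'" using pCons.prems N by simp
    then show ?thesis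
      by (simp add: N sum.lessThan_Suc_shift pCons.IH T_Suc mult.commute del: sum.lessThan_Suc)
  qed
qed simp

text \<open>The derivative terms have lower degree in y, so \<open>a\<close> acts on the leading
  coefficient through \<open>tau\<close> alone.\<close>

lemma coeff_L_top:
  assumes "degree m \<le> n"
  shows "coeff (L m a) n = tau a * coeff m n"
  using assms
proof (induction m arbitrary: n a)
  case (pCons c m)
  show ?case
  proof (cases n)
    case 0
    then have "m = 0" using pCons.prems by (auto split: if_splits)
    then show ?thesis using 0 by (simp add: mult.commute)
  next
    case (Suc k)
    then have "degree m \<le> k" using pCons.prems by (auto split: if_splits)
    then show ?thesis using Suc by (simp add: pCons.IH coeff_eq_0)
  qed
qed simp

section \<open>Stable ideals of k[y] and the degree of a maximal one\<close>

definition stable_ideal :: "'k poly set \<Rightarrow> bool" where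
  "stable_ideal J \<longleftrightarrow> 0 \<in> J \<and> (\<forall>m\<in>J. \<forall>n\<in>J. m + n \<in> J) \<and> (\<forall>n. \<forall>m\<in>J. n * m \<in> J) \<and>
     (\<forall>a. \<forall>m\<in>J. L m a \<in> J)"

text \<open>An element of least degree generates a nonzero J; it is not constant because 1 is not in
  J, so it has a root over the algebraically closed field.\<close>

lemma proper_stable_ideal_root:
  assumes J: "stable_ideal J" and "1 \<notin> J"
  obtains \<beta> where "\<And>m. m \<in> J \<Longrightarrow> poly m \<beta> = 0"
proof (cases "J = {0}")
  case True
  then show ?thesis using that[of 0] by simp
next
  case False
  define m0 where "m0 = arg_min degree (\<lambda>m. m \<in> J - {0})"
  obtain m1 where "m1 \<in> J - {0}" using False J by (auto simp: stable_ideal_def)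
  then have m0: "m0 \<in> J - {0}" and le: "\<And>m. m \<in> J - {0} \<Longrightarrow> degree m0 \<le> degree m"
    unfolding m0_def using arg_min_natI[of "\<lambda>m. m \<in> J - {0}"] arg_min_nat_le[of "\<lambda>m. m \<in> J - {0}"] by blast+
  have dvd: "m0 dvd m" if m: "m \<in> J" for m
  proof (rule ccontr)
    assume "\<not> m0 dvd m"
    then have nz: "m mod m0 \<noteq> 0" by (simp add: mod_eq_0_iff_dvd)
    have "m mod m0 = m + (- (m div m0)) * m0"
      by (simp add: minus_div_mult_eq_mod[symmetric])
    also have "\<dots> \<in> J" using J m m0 unfolding stable_ideal_def by blast
    finally have "degree m0 \<le> degree (m mod m0)" using nz by (intro le) simp
    moreover have "degree (m mod m0) < degree m0"
      using nz m0 degree_mod_less[of m0 m] by auto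
    ultimately show False by simp
  qed
  have "degree m0 > 0"
  proof (rule ccontr)
    assume "\<not> degree m0 > 0"
    then obtain c where c: "m0 = [:c:]" "c \<noteq> 0"
      using m0 by (auto elim: degree_eq_zeroE)
    then have "1 = [:inverse c:] * m0" by (simp add: one_pCons)
    also have "\<dots> \<in> J" using J m0 unfolding stable_ideal_def by blast
    finally show False using assms(2) by simp
  qed
  then obtain \<beta> where "poly m0 \<beta> = 0" using alg_closed_imp_poly_has_root by blast
  then have "poly m \<beta> = 0" if "m \<in> J" for m
    using dvd[OF that] by (auto elim!: dvdE)
  then show ?thesis by (rule that)
qed

text \<open>Let f be the p-polynomial of the relation and \<beta> a common zero of J. Multiplication
  by f commutes with the operators \<open>L\<close>, so J and f - f(\<beta>) generate a stable
  ideal, proper because it vanishes at \<beta>. Maximality puts f - f(\<beta>) into J. A nonzero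
  element of smaller degree would give a relation excluded by \<open>T_independent\<close>.\<close>

lemma maximal_stable_ideal_degree:
  assumes p: "prime CHAR('k)"
    and indep: "\<And>b. (\<And>a. (\<Sum>j<s. b j * T (CHAR('k) ^ j) a) = 0) \<Longrightarrow> \<forall>j<s. b j = 0"
    and rel: "\<And>a. (\<Sum>j\<le>s. b j * T (CHAR('k) ^ j) a) = 0" and b: "j0 \<le> s" "b j0 \<noteq> 0"
    and J: "stable_ideal J" "1 \<notin> J"
    and max: "\<And>S. stable_ideal S \<Longrightarrow> J \<subseteq> S \<Longrightarrow> 1 \<notin> S \<Longrightarrow> S \<subseteq> J"
  obtains m0 where "m0 \<in> J" "degree m0 = CHAR('k) ^ s"
    and "\<And>m. m \<in> J \<Longrightarrow> m \<noteq> 0 \<Longrightarrow> CHAR('k) ^ s \<le> degree m"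
proof -
  have J0: "0 \<in> J" and Jadd: "\<And>m n. m \<in> J \<Longrightarrow> n \<in> J \<Longrightarrow> m + n \<in> J"
    and Jmult: "\<And>n m. m \<in> J \<Longrightarrow> n * m \<in> J" and JL: "\<And>m a. m \<in> J \<Longrightarrow> L m a \<in> J"
    using J(1) by (auto simp: stable_ideal_def)
  \<comment> \<open>Otherwise the relation would involve only exponents below s. The degree of f
    depends on this coefficient.\<close>
  have bs: "b s \<noteq> 0"
  proof
    assume "b s = 0"
    then have "(\<Sum>j<s. b j * T (CHAR('k) ^ j) a) = 0" for a
      using rel[of a] by (simp flip: lessThan_Suc_atMost)
    then have "\<forall>j<s. b j = 0" by (rule indep)
    then show False using b \<open>b s = 0\<close> by (cases "j0 = s") auto
  qed
  define f where "f = ppoly s b"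
  have degf: "degree f = CHAR('k) ^ s" using degree_ppoly[of b s, OF p bs] by (simp add: f_def)
  obtain \<beta> where \<beta>: "\<And>m. m \<in> J \<Longrightarrow> poly m \<beta> = 0"
    using proper_stable_ideal_root[OF J] by blast
  define g where "g = f - [:poly f \<beta>:]"
  have g_root: "poly g \<beta> = 0" by (simp add: g_def)
  have degg: "degree g = CHAR('k) ^ s"
    using p by (simp add: g_def degf diff_conv_add_uminus degree_add_eq_left prime_gt_0_nat del: add_uminus_conv_diff)
  have Lg: "L (g * u) a = g * L u a" for u a
  proof -
    have eq: "g * u = f * u + Polynomial.smult (- poly f \<beta>) u" for u
      by (simp add: g_def algebra_simps)
    show ?thesis
      unfolding eq by (simp only: L_add L_smult f_def L_ppoly_mult[OF p rel])
  qed
  define S where "S = {g * u + m |u m. m \<in> J}"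
  have SI: "g * u + m \<in> S" if "m \<in> J" for u m using that by (auto simp: S_def)
  have "stable_ideal S"
    unfolding stable_ideal_def
  proof (intro conjI ballI allI)
    show "0 \<in> S" using SI[OF J0, of 0] by simp
    fix m assume "m \<in> S"
    then obtain u j where m: "m = g * u + j" "j \<in> J" by (auto simp: S_def)
    show "n * m \<in> S" for n
      using SI[OF Jmult[OF m(2), of n], of "n * u"] by (simp add: m algebra_simps)
    show "L m a \<in> S" for a
      using SI[OF JL[OF m(2)]] by (simp add: m L_add Lg)
    fix n assume "n \<in> S"
    then obtain u' j' where n: "n = g * u' + j'" "j' \<in> J" by (auto simp: S_def)
    show "m + n \<in> S"
      using SI[OF Jadd[OF m(2) n(2)], of "u + u'"] by (simp add: m n algebra_simps)
  qed
  moreover have "J \<subseteq> S" using SI[of _ 0] by auto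
  moreover have "1 \<notin> S"
  proof
    assume "1 \<in> S"
    then obtain u m where "1 = g * u + m" "m \<in> J" by (auto simp: S_def)
    then have "poly 1 \<beta> = 0" using g_root \<beta> by (metis poly_add poly_mult mult_zero_left add_0)
    then show False by simp
  qed
  ultimately have "S \<subseteq> J" by (rule max)
  then have gJ: "g \<in> J" using SI[OF J0, of 1] by auto
  show ?thesis
  proof (rule that[OF gJ degg], rule ccontr)
    fix m1 assume m1: "m1 \<in> J" "m1 \<noteq> 0" "\<not> CHAR('k) ^ s \<le> degree m1"
    define m where "m = arg_min degree (\<lambda>m. m \<in> J - {0})"
    have mJ: "m \<in> J" "m \<noteq> 0" and le: "\<And>m'. m' \<in> J \<Longrightarrow> m' \<noteq> 0 \<Longrightarrow> degree m \<le> degree m'"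
      using arg_min_natI[of "\<lambda>m. m \<in> J - {0}" m1 degree] arg_min_nat_le[of "\<lambda>m. m \<in> J - {0}" _ degree] m1
      unfolding m_def by auto
    define n where "n = degree m"
    have n_less: "n < CHAR('k) ^ s" using le[OF m1(1,2)] m1(3) by (simp add: n_def)
    have n0: "n > 0"
    proof (rule ccontr)
      assume "\<not> n > 0"
      then obtain c where "m = [:c:]" by (auto simp: n_def elim: degree_eq_zeroE)
      then show False using \<beta>[OF mJ(1)] mJ(2) by simp
    qed
    \<comment> \<open>Both sides agree in degree n and have no higher terms, so their difference
      lies in J and has degree below n; minimality makes it zero.\<close>
    have Lm: "L m a = Polynomial.smult (tau a) m" for a
    proof (rule ccontr)
      assume ne: "L m a \<noteq> Polynomial.smult (tau a) m"
      let ?d = "L m a + [:- tau a:] * m"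
      have "?d \<in> J" using mJ by (intro Jadd JL Jmult)
      then have "n \<le> degree ?d" using ne unfolding n_def by (intro le) auto
      moreover have "coeff ?d i = 0" if "n \<le> i" for i
        using that by (simp add: coeff_L_top n_def)
      ultimately have "coeff ?d (degree ?d) = 0" by blast
      then have "?d = 0" by (simp only: leading_coeff_0_iff)
      then show False using ne by simp
    qed
    \<comment> \<open>Comparing constant coefficients in \<open>Lm\<close> turns the coefficients of
      m into a relation among the \<open>T i\<close>.\<close>
    have "(\<Sum>i\<in>{1..n}. coeff m i * T i a) = 0" for a
    proof -
      have "tau a * coeff m 0 = (\<Sum>i<Suc n. coeff m i * T i a)"
        using coeff_L_0[of m "Suc n" a] by (simp add: Lm n_def)
      also have "\<dots> = coeff m 0 * tau a + (\<Sum>i\<in>{1..n}. coeff m i * T i a)"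
        by (simp add: sum.lessThan_Suc_shift sum.atLeast1_atMost_eq del: sum.lessThan_Suc)
      finally show ?thesis by (simp add: mult.commute)
    qed
    then have "\<forall>i\<in>{1..n}. coeff m i = 0"
      using n_less by (intro T_independent[OF p indep])
    then have "coeff m n = 0" using n0 by simp
    then show False using mJ by (simp add: n_def)
  qed
qed

end

section \<open>The commutator with \<open>y\<close> on \<open>k[x] E\<close>\<close>

text \<open>Encodes the commutator of kE with y: since \<open>g_a y = y g_a + a x g_a\<close>,
  moving \<open>u\<close> past y costs x times \<open>weight_deriv u\<close>. It is a derivation
  because \<open>to_ac\<close> is additive.\<close>

definition weight_deriv :: "'f::field group_alg \<Rightarrow> 'f group_alg" where
  "weight_deriv u = Poly_Mapping.mapp (\<lambda>a c. to_ac a * c) u"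

lemma lookup_weight_deriv: "Poly_Mapping.lookup (weight_deriv u) a = to_ac a * Poly_Mapping.lookup u a"
  by (simp add: weight_deriv_def lookup_mapp when_def in_keys_iff)

lemma weight_deriv_single [simp]:
  "weight_deriv (Poly_Mapping.single a c) = Poly_Mapping.single a (to_ac a * c)"
  by (rule poly_mapping_eqI) (simp add: lookup_weight_deriv lookup_single when_def)

lemma weight_deriv_1 [simp]: "weight_deriv 1 = 0"
  by (simp flip: single_one)

lemma weight_deriv_0 [simp]: "weight_deriv 0 = 0"
  by (rule poly_mapping_eqI) (simp add: lookup_weight_deriv)

lemma weight_deriv_add: "weight_deriv (u + v) = weight_deriv u + weight_deriv v"
  by (rule poly_mapping_eqI) (simp add: lookup_weight_deriv lookup_add algebra_simps)

lemma weight_deriv_mult: "weight_deriv (u * v) = weight_deriv u * v + u * weight_deriv v"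
proof (induction u rule: poly_mapping_single_add_induct)
  case (single a c)
  show ?case
    by (induction v rule: poly_mapping_single_add_induct)
      (simp_all add: mult_single weight_deriv_add algebra_simps flip: single_add)
qed (simp add: weight_deriv_add algebra_simps)

definition aug :: "'f::{finite,field} group_alg \<Rightarrow> 'f alg_closure" where
  "aug u = (\<Sum>a\<in>UNIV. Poly_Mapping.lookup u a)"

lemma aug_single [simp]: "aug (Poly_Mapping.single a c) = c"
  by (simp add: aug_def lookup_single when_def)

lemma aug_0 [simp]: "aug 0 = 0"
  by (simp add: aug_def)

lemma aug_add: "aug (u + v) = aug u + aug v"
  by (simp add: aug_def lookup_add sum.distrib)

lemma aug_mult: "aug (u * v) = aug u * aug v"
proof (induction u rule: poly_mapping_single_add_induct)
  case (single a c)
  show ?case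
    by (induction v rule: poly_mapping_single_add_induct)
      (simp_all add: mult_single aug_add algebra_simps)
qed (simp add: aug_add algebra_simps)

lemma aug_1 [simp]: "aug 1 = 1"
  by (simp flip: single_one)

text \<open>
  Polynomials in \<open>x\<close> over the group algebra; modulo the relation of \<open>H\<^sub>\<lambda>\<close>, the commutator with
  \<open>y\<close> is the derivation \<open>comm_deriv\<close>.
\<close>

definition comm_deriv :: "'f::{finite,field} group_alg \<Rightarrow> 'f group_alg poly \<Rightarrow> 'f group_alg poly" where
  "comm_deriv lam P = snd (fold_coeffs
     (\<lambda>u Z. (pCons u (fst Z), [:0, weight_deriv u:] + Polynomial.smult lam (fst Z) + pCons 0 (snd Z))) P (0, 0))"

lemma comm_deriv_0 [simp]: "comm_deriv lam 0 = 0"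
  by (simp add: comm_deriv_def)

lemma comm_deriv_pCons [simp]:
  "comm_deriv lam (pCons u P) = [:0, weight_deriv u:] + Polynomial.smult lam P + pCons 0 (comm_deriv lam P)"
proof -
  let ?f = "\<lambda>u Z. (pCons u (fst Z), [:0, weight_deriv u:] + Polynomial.smult lam (fst Z) + pCons 0 (snd Z))"
  have f0: "?f 0 (0, 0) = (0, 0)" by simp
  \<comment> \<open>The recursion needs the tail of the polynomial itself, so the fold carries a
    pair whose first component rebuilds it.\<close>
  have fst: "fst (fold_coeffs ?f P (0, 0)) = P" for P
    by (induction P) (simp_all add: fold_coeffs_pCons'[of ?f, OF f0])
  show ?thesis
    unfolding comm_deriv_def fold_coeffs_pCons'[of ?f, OF f0]
    by (simp add: fst)
qed

lemma comm_deriv_add: "comm_deriv lam (P + Q) = comm_deriv lam P + comm_deriv lam Q"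
  by (induction P Q rule: poly_induct2)
    (simp_all add: weight_deriv_add smult_add_right algebra_simps)

lemma comm_deriv_smult:
  "comm_deriv lam (Polynomial.smult u P) = [:0, weight_deriv u:] * P + Polynomial.smult u (comm_deriv lam P)"
  by (induction P) (simp_all add: weight_deriv_mult smult_add_right algebra_simps)

lemma comm_deriv_mult: "comm_deriv lam (P * Q) = comm_deriv lam P * Q + P * comm_deriv lam Q"
  by (induction P)
    (simp_all add: comm_deriv_add comm_deriv_smult smult_add_right algebra_simps)

text \<open>The character by which kE[x] acts on the generating vector of a quotient of
  \<open>Delta\<close>; see \<open>x_embed_v\<close>.\<close>

definition point :: "'f::{finite,field} alg_closure \<Rightarrow> 'f group_alg poly \<Rightarrow> 'f alg_closure" where
  "point \<alpha> P = aug (poly P (Poly_Mapping.single 0 \<alpha>))"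

definition scalar :: "'f::{finite,field} alg_closure \<Rightarrow> 'f group_alg poly" where
  "scalar c = [:Poly_Mapping.single 0 c:]"

lemma point_pCons [simp]: "point \<alpha> (pCons u P) = aug u + \<alpha> * point \<alpha> P"
  by (simp add: point_def aug_add aug_mult)

lemma point_0 [simp]: "point \<alpha> 0 = 0"
  by (simp add: point_def)

lemma derivation_at_point: "derivation_at_point (comm_deriv lam) (point \<alpha>) scalar"
  by unfold_locales
    (simp_all add: comm_deriv_add comm_deriv_mult scalar_def one_pCons, simp_all add: point_def aug_add aug_mult)

section \<open>Finite fields and linear relations\<close>

lemma prime_CHAR_finite: "prime CHAR('f::{finite,field})"
  by (intro prime_CHAR_semidom finite_imp_CHAR_pos) simp

text \<open>Multiplication by a nonzero \<open>a\<close> permutes the nonzero elements, so their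
  product can be compared with itself.\<close>

lemma finite_field_power_card:
  fixes a :: "'f::{finite,field}"
  shows "a ^ CARD('f) = a"
proof (cases "a = 0")
  case False
  have "a ^ (CARD('f) - 1) * \<Prod>(UNIV - {0}) = (\<Prod>y\<in>UNIV - {0}. a * y)"
    by (simp add: prod.distrib)
  also have "\<dots> = \<Prod>(UNIV - {0})"
    by (rule prod.reindex_bij_witness[of _ "\<lambda>y. y / a" "\<lambda>y. a * y"]) (use False in auto)
  finally have "a ^ (CARD('f) - 1) = 1" by simp
  then show ?thesis
    using power_minus_mult[of "CARD('f)" a] by simp
qed simp

text \<open>The span of the first m powers of \<xi> is sent by \<xi> into the span of the first m +
  1. If \<xi>^m already lies in the former for some m < r, that span is stable under \<xi> and
  contains 1, hence everything. Otherwise each new power multiplies the size by p, and r powers fill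
  the field. The set S is arbitrary because the fact is applied both to zero sets of functionals and
  to the stabiliser of a vector.\<close>

lemma power_sum_generators:
  fixes \<xi> :: "'f::{finite,field}"
  assumes p: "prime CHAR('f)" and card: "CARD('f) = CHAR('f) ^ r"
    and \<xi>: "range (\<lambda>n::nat. \<xi> ^ n) = UNIV - {0}"
    and S: "0 \<in> S" "\<And>a b. a \<in> S \<Longrightarrow> b \<in> S \<Longrightarrow> a + b \<in> S" "\<And>i. i < r \<Longrightarrow> \<xi> ^ i \<in> S"
  shows "S = UNIV"
proof -
  \<comment> \<open>\<open>E m\<close> is the span over the prime field of the first m powers of
    \<xi>, with natural numbers as scalars.\<close>
  define E where "E = rec_nat {0} (\<lambda>m E. {s + of_nat c * \<xi> ^ m |s c. s \<in> E})"
  have E0: "E 0 = {0}" and ESuc: "E (Suc m) = {s + of_nat c * \<xi> ^ m |s c. s \<in> E m}" for m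
    by (simp_all add: E_def)
  have zero: "0 \<in> E m" for m
    by (induction m) (auto simp: E0 ESuc intro!: exI[of _ 0])
  have add: "a \<in> E m \<Longrightarrow> b \<in> E m \<Longrightarrow> a + b \<in> E m" for a b m
  proof (induction m arbitrary: a b)
    case (Suc m)
    from Suc.prems obtain s c t d where *: "s \<in> E m" "t \<in> E m"
      and "a = s + of_nat c * \<xi> ^ m" "b = t + of_nat d * \<xi> ^ m"
      by (auto simp: ESuc)
    then have "a + b = (s + t) + of_nat (c + d) * \<xi> ^ m" by (simp add: algebra_simps)
    then show ?case using Suc.IH[OF *] unfolding ESuc by blast
  qed (simp add: E0)
  have nat_mult: "of_nat n * a \<in> E m" if "a \<in> E m" for n a m
    by (induction n) (simp_all add: zero add that distrib_right)
  have closed: "of_nat n * a \<in> S" if "a \<in> S" for n a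
    by (induction n) (simp_all add: S that distrib_right)
  have sub: "m \<le> r \<Longrightarrow> E m \<subseteq> S" for m
  proof (induction m)
    case (Suc m)
    then show ?case unfolding ESuc by (auto intro!: S closed)
  qed (simp add: E0 S)
  have mult: "a * \<xi> \<in> E (Suc m)" if "a \<in> E m" for a m
    using that
  proof (induction m arbitrary: a)
    case (Suc m)
    then obtain s c where s: "s \<in> E m" "a = s + of_nat c * \<xi> ^ m" by (auto simp: ESuc)
    then have "a * \<xi> = s * \<xi> + of_nat c * \<xi> ^ Suc m" by (simp add: algebra_simps)
    then show ?case using Suc.IH[OF s(1)] unfolding ESuc[of "Suc m"] by blast
  qed (simp add: E0 zero)
  have full: "E m = UNIV" if m: "\<xi> ^ m \<in> E m" for m
  proof -
    have sub_m: "E (Suc m) \<subseteq> E m"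
      unfolding ESuc using m by (auto intro!: add nat_mult)
    have "1 \<in> E m"
    proof (cases m)
      case 0
      then show ?thesis using m by (simp add: E0)
    next
      case (Suc k)
      have "1 \<in> E (Suc j)" for j
      proof (induction j)
        case 0
        show ?case by (auto simp: ESuc E0 intro!: exI[of _ "1::nat"])
      next
        case (Suc j)
        have "1 = 1 + of_nat 0 * \<xi> ^ Suc j" by simp
        then show ?case unfolding ESuc[of "Suc j"] using Suc by blast
      qed
      then show ?thesis by (simp add: Suc)
    qed
    have "\<xi> ^ n \<in> E m" for n
    proof (induction n)
      case (Suc n)
      then show ?case using mult[of "\<xi> ^ n" m] sub_m by (auto simp: mult.commute)
    qed (simp add: \<open>1 \<in> E m\<close>)
    then have "range (\<lambda>n. \<xi> ^ n) \<subseteq> E m" by blast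
    moreover have "x \<in> range (\<lambda>n. \<xi> ^ n)" if "x \<noteq> 0" for x
      using that unfolding \<xi> by simp
    ultimately show ?thesis using zero by (metis UNIV_eq_I subsetD)
  qed
  have "(\<exists>m<r. \<xi> ^ m \<in> E m) \<or> (\<forall>m<r. \<xi> ^ m \<notin> E m)" by blast
  then show ?thesis
  proof
    assume "\<exists>m<r. \<xi> ^ m \<in> E m"
    then show ?thesis using full sub by (metis less_imp_le top.extremum_uniqueI)
  next
    assume new: "\<forall>m<r. \<xi> ^ m \<notin> E m"
    have "m \<le> r \<Longrightarrow> card (E m) \<ge> CHAR('f) ^ m" for m
    proof (induction m)
      case (Suc m)
      let ?f = "\<lambda>(s, c). s + of_nat c * \<xi> ^ m"
      \<comment> \<open>Subtracting gives e \<xi>^m in \<open>E m\<close> with 0 < e < p, where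
        adding p - 1 copies serves as subtraction. Inverting e modulo p then puts \<xi>^m into
        \<open>E m\<close>.\<close>
      have less: False if "s \<in> E m" "t \<in> E m" "c < d" "d < CHAR('f)"
        and eq: "s + of_nat c * \<xi> ^ m = t + of_nat d * \<xi> ^ m" for s t c d
      proof -
        define e where "e = d - c"
        have d: "d = c + e" using that by (simp add: e_def)
        have e: "0 < e" "e < CHAR('f)" using that by (auto simp: e_def)
        have se: "s = t + of_nat e * \<xi> ^ m" using eq by (simp add: d algebra_simps)
        have "of_nat (CHAR('f) - 1) + 1 = (of_nat CHAR('f) :: 'f)"
          using p by (metis Suc_diff_1 add.commute of_nat_Suc prime_gt_0_nat)
        then have "of_nat (CHAR('f) - 1) = (- 1 :: 'f)"
          by (simp add: eq_neg_iff_add_eq_0)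
        then have "s + of_nat (CHAR('f) - 1) * t = of_nat e * \<xi> ^ m"
          using se by simp
        then have in_E: "of_nat e * \<xi> ^ m \<in> E m"
          using that add nat_mult by metis
        have "coprime e CHAR('f)"
          using e p by (metis coprime_commute nat_dvd_not_less prime_imp_coprime)
        then obtain x where "[e * x = 1] (mod CHAR('f))"
          using cong_solve_coprime_nat by auto
        then have "of_nat (e * x) = (1 :: 'f)"
          by (metis cong_def of_nat_1 of_nat_eq_iff_cong_CHAR)
        then have "\<xi> ^ m = of_nat x * (of_nat e * \<xi> ^ m)"
          by (simp add: mult.assoc[symmetric] mult.commute)
        then have "\<xi> ^ m \<in> E m" using nat_mult[OF in_E, of x] by metis
        then show False using new Suc.prems by auto
      qed
      have cd: "c = d" if "s \<in> E m" "t \<in> E m" "c < CHAR('f)" "d < CHAR('f)"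
        and eq: "s + of_nat c * \<xi> ^ m = t + of_nat d * \<xi> ^ m" for s t c d
        using less[OF that(1,2) _ _ eq] less[OF that(2,1) _ _ eq[symmetric]] that(3,4)
        by (cases c d rule: linorder_cases) auto
      have "inj_on ?f (E m \<times> {..<CHAR('f)})"
      proof (rule inj_onI)
        fix u v assume "u \<in> E m \<times> {..<CHAR('f)}" "v \<in> E m \<times> {..<CHAR('f)}" "?f u = ?f v"
        then show "u = v"
          using cd[of "fst u" "fst v" "snd u" "snd v"] by (auto simp: case_prod_unfold prod_eq_iff)
      qed
      then have "card (E m \<times> {..<CHAR('f)}) \<le> card (E (Suc m))"
        by (rule card_inj_on_le) (auto simp: ESuc)
      moreover have "CHAR('f) ^ m \<le> card (E m)" using Suc by simp
      ultimately show ?case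
        by (simp add: card_cartesian_product) (metis mult.commute mult_le_mono2 order.trans)
    qed (simp add: E0)
    then have "CARD('f) \<le> card (E r)" using card by simp
    moreover have "card (E r) \<le> CARD('f)" by (intro card_mono) auto
    ultimately have "E r = UNIV" by (intro card_subset_eq) auto
    then show ?thesis using sub[of r] by auto
  qed
qed

text \<open>There are n equations in n + 1 unknowns; an added zero row makes the matrix square and
  singular.\<close>

lemma nontrivial_relation:
  fixes c :: "nat \<Rightarrow> nat \<Rightarrow> 'k::field"
  obtains b j0 where "j0 \<le> n" "b j0 \<noteq> 0" "\<And>i. i < n \<Longrightarrow> (\<Sum>j\<le>n. b j * c i j) = 0"
proof -
  define A where "A = mat (Suc n) (Suc n) (\<lambda>(i, j). if i < n then c i j else 0)"
  have A: "A \<in> carrier_mat (Suc n) (Suc n)" by (simp add: A_def)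
  have "A = mat\<^sub>r (Suc n) (Suc n) (\<lambda>i. if i = n then 0\<^sub>v (Suc n) else vec (Suc n) (c i))"
    by (rule eq_matI) (auto simp: A_def)
  then have "det A = 0" by (simp only:) (rule det_row_0, auto)
  then obtain v where v: "v \<in> carrier_vec (Suc n)" "v \<noteq> 0\<^sub>v (Suc n)" "A *\<^sub>v v = 0\<^sub>v (Suc n)"
    using det_0_iff_vec_prod_zero_field[OF A] by blast
  obtain j0 where "j0 \<le> n" "v $ j0 \<noteq> 0"
    using v(1,2) by (metis carrier_vecD eq_vecI index_zero_vec less_Suc_eq_le)
  moreover have "(\<Sum>j\<le>n. v $ j * c i j) = 0" if "i < n" for i
  proof -
    have "(A *\<^sub>v v) $ i = 0" using v(3) that by simp
    then show ?thesis
      using that v(1) by (simp add: A_def scalar_prod_def atLeast0LessThan lessThan_Suc_atMost mult.commute)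
  qed
  ultimately show ?thesis by (rule that)
qed

lemma poly_vanishing_on_finite_field:
  fixes P :: "'f::{finite,field} alg_closure poly"
  assumes "degree P < CARD('f)" and "\<And>a. poly P (to_ac a) = 0"
  shows "P = 0"
proof (rule ccontr)
  assume P: "P \<noteq> 0"
  have "CARD('f) = card (range (to_ac :: 'f \<Rightarrow> _))"
    by (rule card_image[OF inj_to_ac, symmetric])
  also have "\<dots> \<le> card {x. poly P x = 0}"
    using assms(2) by (intro card_mono poly_roots_finite P) auto
  also have "\<dots> \<le> degree P" by (rule card_poly_roots_bound[OF P])
  finally show False using assms(1) by simp
qed

section \<open>The critical exponent\<close>

context derivation_at_point
begin

text \<open>Independence below \<open>s\<close> forces \<open>b s\<close> to be nonzero in the
  second clause, so \<open>s\<close> is the exponent at which these functionals first become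
  dependent. The dimension will be p^s.\<close>

definition critical :: "nat \<Rightarrow> bool" where
  "critical s \<longleftrightarrow> (\<forall>b. (\<forall>a. (\<Sum>j<s. b j * T (CHAR('k) ^ j) a) = 0) \<longrightarrow> (\<forall>j<s. b j = 0)) \<and>
     (\<exists>b. (\<exists>j\<le>s. b j \<noteq> 0) \<and> (\<forall>a. (\<Sum>j\<le>s. b j * T (CHAR('k) ^ j) a) = 0))"

end

section \<open>The functionals for the algebra kE[x]\<close>

locale crossed_data =
  fixes lam :: "'f::{finite,field} group_alg" and \<alpha> :: "'f alg_closure"
begin

sublocale derivation_at_point "comm_deriv lam" "point \<alpha>" scalar
  by (rule derivation_at_point)

abbreviation xgen :: "'f group_alg poly" where "xgen \<equiv> [:0, 1:]"

abbreviation ggen :: "'f \<Rightarrow> 'f group_alg poly" where "ggen a \<equiv> [:Poly_Mapping.single a 1:]"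

abbreviation Dp :: "nat \<Rightarrow> 'f group_alg poly \<Rightarrow> 'f alg_closure" where "Dp j \<equiv> T (CHAR('f) ^ j)"

lemma prime_CHAR: "prime CHAR('f)"
  by (rule prime_CHAR_finite)

lemma Dp_mult: "Dp j (a * b) = point \<alpha> a * Dp j b + Dp j a * point \<alpha> b"
  using T_power_char_mult[of j a b] prime_CHAR by simp

lemma ggen_add: "ggen (a + b) = ggen a * ggen b"
  by (simp add: mult_single add.commute)

lemma point_xgen: "point \<alpha> xgen = \<alpha>" and point_ggen: "point \<alpha> (ggen a) = 1"
  by simp_all

lemma delta_ggen: "comm_deriv lam (ggen a) = scalar (to_ac a) * xgen * ggen a"
  by (simp add: scalar_def mult_single)

text \<open>A derivation at a point where every group element has value 1 is a homomorphism from E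
  to the additive group of k. Hence it is enough to test it on r generators of E.\<close>

lemma Dp_combination_ggen_add:
  "(\<Sum>j\<in>B. b j * Dp j (ggen (a + a'))) = (\<Sum>j\<in>B. b j * Dp j (ggen a)) + (\<Sum>j\<in>B. b j * Dp j (ggen a'))"
  by (simp only: ggen_add Dp_mult point_ggen) (simp add: distrib_left sum.distrib)

lemma Dp_combination_group_alg:
  assumes "\<And>a. (\<Sum>j\<in>B. b j * Dp j (ggen a)) = 0"
  shows "(\<Sum>j\<in>B. b j * Dp j [:u:]) = 0"
proof (induction u rule: poly_mapping_single_add_induct)
  case (single a c)
  have "[:Poly_Mapping.single a c:] = scalar c * ggen a"
    by (simp add: scalar_def mult_single)
  then have "(\<Sum>j\<in>B. b j * Dp j [:Poly_Mapping.single a c:]) = c * (\<Sum>j\<in>B. b j * Dp j (ggen a))"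
    by (simp only: T_const_mult) (simp add: sum_distrib_left mult_ac)
  then show ?case by (simp only: assms) simp
next
  case (add u v)
  have "[:u + v:] = [:u:] + [:v:]" by simp
  then show ?case using add by (simp only: T_add distrib_left sum.distrib) simp
qed

text \<open>A combination of point derivations is again one, and is determined by its values on
  algebra generators.\<close>

lemma Dp_combination_eq_0:
  assumes X': "(\<Sum>j\<in>B. b j * Dp j xgen) = 0" and G': "\<And>a. (\<Sum>j\<in>B. b j * Dp j (ggen a)) = 0"
  shows "(\<Sum>j\<in>B. b j * Dp j P) = 0"
proof (induction P)
  case (pCons u P)
  have "pCons u P = [:u:] + xgen * P" by simp
  then have "(\<Sum>j\<in>B. b j * Dp j (pCons u P)) = (\<Sum>j\<in>B. b j * Dp j [:u:]) +
      (\<alpha> * (\<Sum>j\<in>B. b j * Dp j P) + (\<Sum>j\<in>B. b j * Dp j xgen) * point \<alpha> P)"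
    by (simp only: T_add Dp_mult point_xgen) (simp add: distrib_left sum.distrib sum_distrib_left sum_distrib_right mult_ac)
  then show ?case by (simp only: Dp_combination_group_alg[OF G'] X' pCons.IH) simp
qed simp

text \<open>\<open>\<delta>\<^sup>n g\<^sub>a = (\<Sum>\<^sub>i a\<^sup>i gcoef\<^sub>n\<^sub>,\<^sub>i) g\<^sub>a\<close> with coefficients independent of \<open>a\<close>.\<close>

fun gcoef :: "nat \<Rightarrow> nat \<Rightarrow> 'f group_alg poly" where
  "gcoef 0 i = (if i = 0 then 1 else 0)"
| "gcoef (Suc n) i = comm_deriv lam (gcoef n i) + (if i = 0 then 0 else xgen * gcoef n (i - 1))"

lemma gcoef_eq_0: "n < i \<Longrightarrow> gcoef n i = 0"
  by (induction n arbitrary: i) auto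

lemma gcoef_diag: "gcoef n n = xgen ^ n"
  by (induction n) (simp_all add: gcoef_eq_0)

lemma gcoef_Suc_0: "gcoef (Suc n) 0 = 0"
  by (induction n) simp_all

text \<open>The coefficient at index 0 vanishes after the first step, so the part linear in a arises
  once, as x, and is only differentiated afterwards.\<close>

lemma gcoef_Suc_1: "gcoef (Suc n) 1 = (comm_deriv lam ^^ n) xgen"
proof (induction n)
  case (Suc n)
  have "gcoef (Suc (Suc n)) 1 = comm_deriv lam (gcoef (Suc n) 1) + xgen * gcoef (Suc n) 0"
    by (simp only: gcoef.simps) simp
  then show ?case by (simp only: gcoef_Suc_0 Suc.IH funpow.simps comp_def) simp
qed simp

lemma funpow_delta_ggen:
  "(comm_deriv lam ^^ n) (ggen a) = (\<Sum>i\<le>n. scalar (to_ac a ^ i) * gcoef n i) * ggen a"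
proof (induction n)
  case 0
  show ?case by (simp add: scalar_def)
next
  case (Suc n)
  let ?s = "\<lambda>i. scalar (to_ac a ^ i)"
  have s_Suc: "?s (Suc i) = ?s i * scalar (to_ac a)" for i
    by (simp add: scalar_def mult_single mult.commute)
  have delta_sum: "comm_deriv lam (\<Sum>i\<le>n. ?s i * gcoef n i) = (\<Sum>i\<le>n. ?s i * comm_deriv lam (gcoef n i))"
    using funpow_delta_sum[of 1 "\<lambda>i. ?s i * gcoef n i" "{..n}"] by (simp add: delta_mult delta_const)
  let ?S = "\<Sum>i\<le>n. ?s i * gcoef n i"
  have "(comm_deriv lam ^^ Suc n) (ggen a) = comm_deriv lam ?S * ggen a + ?S * (scalar (to_ac a) * xgen * ggen a)"
    by (simp only: funpow.simps comp_def Suc delta_mult delta_ggen)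
  also have "\<dots> = (comm_deriv lam ?S + ?S * (scalar (to_ac a) * xgen)) * ggen a"
    by (simp only: distrib_right mult.assoc)
  also have "?S * (scalar (to_ac a) * xgen) = (\<Sum>i\<le>n. ?s (Suc i) * (xgen * gcoef n i))"
    unfolding s_Suc sum_distrib_right by (intro sum.cong refl) (simp only: mult_ac)
  also have "comm_deriv lam ?S = (\<Sum>i\<le>n. ?s i * comm_deriv lam (gcoef n i))"
    by (rule delta_sum)
  also have "(\<Sum>i\<le>n. ?s i * comm_deriv lam (gcoef n i)) = (\<Sum>i\<le>Suc n. ?s i * comm_deriv lam (gcoef n i))"
    by (simp add: gcoef_eq_0)
  also have "(\<Sum>i\<le>n. ?s (Suc i) * (xgen * gcoef n i)) =
      (\<Sum>i\<le>Suc n. ?s i * (if i = 0 then 0 else xgen * gcoef n (i - 1)))"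
    by (subst sum.atMost_Suc_shift) simp
  also have "(\<Sum>i\<le>Suc n. ?s i * comm_deriv lam (gcoef n i)) + \<dots> = (\<Sum>i\<le>Suc n. ?s i * gcoef (Suc n) i)"
    by (simp only: gcoef.simps distrib_left sum.distrib)
  finally show ?case .
qed

definition gpoly :: "nat \<Rightarrow> 'f alg_closure poly" where
  "gpoly n = (\<Sum>i\<le>n. monom (point \<alpha> (gcoef n i)) i)"

lemma T_ggen: "T n (ggen a) = poly (gpoly n) (to_ac a)"
  by (simp only: T_def funpow_delta_ggen tau_mult tau_sum tau_const point_ggen gpoly_def)
    (simp add: poly_sum poly_monom mult.commute)

lemma coeff_gpoly: "coeff (gpoly n) i = point \<alpha> (gcoef n i)"
proof -
  have "coeff (gpoly n) i = (\<Sum>l\<le>n. if l = i then point \<alpha> (gcoef n i) else 0)"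
    unfolding gpoly_def coeff_sum by (intro sum.cong) auto
  then show ?thesis by (simp add: gcoef_eq_0)
qed

lemma point_xgen_power: "point \<alpha> (xgen ^ n) = \<alpha> ^ n"
proof (induction n)
  case (Suc n)
  then show ?case unfolding power_Suc tau_mult by (simp only: Suc point_xgen)
qed simp

lemma coeff_gpoly_top: "coeff (gpoly n) n = \<alpha> ^ n"
  by (simp only: coeff_gpoly gcoef_diag point_xgen_power)

lemma coeff_gpoly_1: "n > 0 \<Longrightarrow> coeff (gpoly n) 1 = T (n - 1) xgen"
  by (cases n) (simp_all only: coeff_gpoly gcoef_Suc_1 T_def diff_Suc_1)

lemma degree_gpoly: "degree (gpoly n) \<le> n"
  by (rule degree_le) (simp add: coeff_gpoly gcoef_eq_0)

lemma Dp_ggen_sum: "(\<Sum>j\<in>B. b j * Dp j (ggen a)) =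
    poly (\<Sum>j\<in>B. Polynomial.smult (b j) (gpoly (CHAR('f) ^ j))) (to_ac a)"
  by (simp only: T_ggen poly_sum poly_smult)

lemma degree_gpoly_combination: "degree (\<Sum>j<s. Polynomial.smult (b j) (gpoly (CHAR('f) ^ j))) < CHAR('f) ^ s"
proof -
  have p1: "CHAR('f) > 1" using prime_CHAR by (rule prime_gt_1_nat)
  have "degree (\<Sum>j<s. Polynomial.smult (b j) (gpoly (CHAR('f) ^ j))) \<le> CHAR('f) ^ s - 1"
  proof (rule degree_sum_le)
    fix j assume "j \<in> {..<s}"
    then have "CHAR('f) ^ j < CHAR('f) ^ s" using p1 by simp
    then show "degree (Polynomial.smult (b j) (gpoly (CHAR('f) ^ j))) \<le> CHAR('f) ^ s - 1"
      using degree_smult_le[of "b j" "gpoly (CHAR('f) ^ j)"] degree_gpoly[of "CHAR('f) ^ j"] by linarith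
  qed simp
  moreover have "CHAR('f) ^ s > 0" using p1 by simp
  ultimately show ?thesis by linarith
qed

text \<open>For nonzero \<alpha> the top coefficient \<open>\<alpha> ^ n\<close> shows that
  \<open>gpoly n\<close> has exact degree n, and distinct degrees give independence.\<close>

lemma gpoly_independent:
  assumes "\<alpha> \<noteq> 0" and "(\<Sum>j<s. Polynomial.smult (b j) (gpoly (CHAR('f) ^ j))) = 0"
  shows "\<forall>j<s. b j = 0"
  using assms(2)
proof (induction s)
  case (Suc s)
  let ?P = "\<Sum>j<s. Polynomial.smult (b j) (gpoly (CHAR('f) ^ j))"
  have sum: "?P + Polynomial.smult (b s) (gpoly (CHAR('f) ^ s)) = 0"
    using Suc.prems by (simp only: sum.lessThan_Suc)
  have "coeff ?P (CHAR('f) ^ s) = 0"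
    by (rule coeff_eq_0[OF degree_gpoly_combination])
  then have "b s * \<alpha> ^ CHAR('f) ^ s = coeff (?P + Polynomial.smult (b s) (gpoly (CHAR('f) ^ s))) (CHAR('f) ^ s)"
    by (simp only: coeff_add coeff_smult coeff_gpoly_top add_0_left)
  also have "\<dots> = 0"
    unfolding sum by (rule coeff_0)
  finally have bs: "b s = 0" using assms(1) by simp
  then have "?P = 0" using sum by (simp only: smult_0_left add_0_right)
  then have "\<forall>j<s. b j = 0" by (rule Suc.IH)
  then show ?case using bs by (simp only: less_Suc_eq) blast
qed simp

text \<open>The polynomial in a has degree below q, so vanishing on the whole finite field already
  makes it zero.\<close>

lemma Dp_independent:
  assumes "\<alpha> \<noteq> 0" and "CARD('f) = CHAR('f) ^ r" and "\<And>a. (\<Sum>j<r. b j * Dp j (ggen a)) = 0"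
  shows "\<forall>j<r. b j = 0"
proof (rule gpoly_independent[OF assms(1)], rule poly_vanishing_on_finite_field)
  show "degree (\<Sum>j<r. Polynomial.smult (b j) (gpoly (CHAR('f) ^ j))) < CARD('f)"
    using degree_gpoly_combination[of b r] assms(2) by simp
  show "poly (\<Sum>j<r. Polynomial.smult (b j) (gpoly (CHAR('f) ^ j))) (to_ac a) = 0" for a
    using assms(3)[of a] by (simp only: Dp_ggen_sum)
qed

text \<open>The element \<open>x\<^sup>2 - 2 \<mu>\<close> with \<open>\<mu> = \<Sum> (c\<^sub>a / a) g\<^sub>a\<close>; the summand with \<open>a = 0\<close> drops out as \<open>c / 0 = 0\<close>.\<close>

definition zelt :: "'f group_alg poly" where
  "zelt = [:- (Poly_Mapping.mapp (\<lambda>a c. c / to_ac a) lam + Poly_Mapping.mapp (\<lambda>a c. c / to_ac a) lam), 0, 1:]"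

lemma delta_square: "comm_deriv lam [:u, 0, 1:] = [:0, weight_deriv u + (lam + lam):]"
  by simp

text \<open>\<open>weight_deriv\<close> multiplies the coefficient at a by a and so undoes the
  division by a except at a = 0; there the contribution 2 c_0 of x^2 stays uncancelled.\<close>

lemma delta_zelt: "comm_deriv lam zelt = scalar (2 * Poly_Mapping.lookup lam 0) * xgen"
proof -
  let ?\<mu> = "Poly_Mapping.mapp (\<lambda>a c. c / to_ac a) lam"
  have "weight_deriv (- (?\<mu> + ?\<mu>)) + (lam + lam) =
      Poly_Mapping.single 0 (2 * Poly_Mapping.lookup lam 0)"
  proof (rule poly_mapping_eqI)
    fix a
    show "Poly_Mapping.lookup (weight_deriv (- (?\<mu> + ?\<mu>)) + (lam + lam)) a =
        Poly_Mapping.lookup (Poly_Mapping.single 0 (2 * Poly_Mapping.lookup lam 0)) a"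
      unfolding lookup_add lookup_weight_deriv lookup_uminus
      by (auto simp: lookup_mapp lookup_single when_def in_keys_iff)
  qed
  then have "comm_deriv lam zelt = [:0, Poly_Mapping.single 0 (2 * Poly_Mapping.lookup lam 0):]"
    unfolding zelt_def delta_square by (simp only:)
  then show ?thesis
    unfolding scalar_def by (simp only: mult_pCons_left mult_zero_left smult_pCons) simp
qed

lemma Dp_zelt: "Dp j zelt = 2 * Poly_Mapping.lookup lam 0 * T (CHAR('f) ^ j - 1) xgen"
proof (cases "CHAR('f) ^ j")
  case 0
  then show ?thesis using prime_gt_0_nat[OF prime_CHAR] by simp
next
  case (Suc n)
  show ?thesis by (simp only: Suc T_Suc delta_zelt T_const_mult diff_Suc_1)
qed

lemma two_nonzero:
  assumes "odd CHAR('f)"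
  shows "(2 :: 'f alg_closure) \<noteq> 0"
proof
  assume "(2 :: 'f alg_closure) = 0"
  then have "CHAR('f) dvd 2"
    using of_nat_eq_0_iff_char_dvd[of 2, where ?'a = "'f alg_closure"] by simp
  then have "CHAR('f) = 2"
    using primes_dvd_imp_eq[OF prime_CHAR two_is_prime_nat] by simp
  then show False using assms by simp
qed

text \<open>The group algebra part of \<open>zelt\<close> is killed by hypothesis, and the product
  rule applies to x^2.\<close>

lemma Dp_combination_zelt:
  assumes "\<And>a. (\<Sum>j\<in>B. b j * Dp j (ggen a)) = 0"
  shows "(\<Sum>j\<in>B. b j * Dp j zelt) = 2 * \<alpha> * (\<Sum>j\<in>B. b j * Dp j xgen)"
proof -
  let ?u = "- (Poly_Mapping.mapp (\<lambda>a c. c / to_ac a) lam + Poly_Mapping.mapp (\<lambda>a c. c / to_ac a) lam)"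
  have alg: "c * (u + (\<alpha> * d + d * \<alpha>)) = c * u + 2 * \<alpha> * (c * d)" for c d u
    by (simp add: algebra_simps)
  have "zelt = [:?u:] + xgen * xgen" by (simp add: zelt_def)
  then have "(\<Sum>j\<in>B. b j * Dp j zelt) = (\<Sum>j\<in>B. b j * Dp j [:?u:]) + 2 * \<alpha> * (\<Sum>j\<in>B. b j * Dp j xgen)"
    by (simp only: T_add Dp_mult point_xgen alg sum.distrib sum_distrib_left)
  then show ?thesis by (simp only: Dp_combination_group_alg[OF assms]) simp
qed

section \<open>Parity in x\<close>

definition has_parity :: "bool \<Rightarrow> 'f group_alg poly \<Rightarrow> bool" where
  "has_parity e P \<longleftrightarrow> (\<forall>i. even i \<noteq> e \<longrightarrow> coeff P i = 0)"

lemma has_parity_pCons: "has_parity e (pCons u P) \<longleftrightarrow> (e \<or> u = 0) \<and> has_parity (\<not> e) P"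
proof
  assume *: "has_parity e (pCons u P)"
  have "coeff P i = 0" if "even i \<noteq> (\<not> e)" for i
    using *[unfolded has_parity_def, rule_format, of "Suc i"] that by auto
  moreover have "e \<or> u = 0"
    using *[unfolded has_parity_def, rule_format, of 0] by (cases e) auto
  ultimately show "(e \<or> u = 0) \<and> has_parity (\<not> e) P"
    by (auto simp: has_parity_def)
next
  assume "(e \<or> u = 0) \<and> has_parity (\<not> e) P"
  then show "has_parity e (pCons u P)"
    by (auto simp: has_parity_def coeff_pCons split: nat.splits)
qed

lemma has_parity_0: "has_parity e 0"
  by (simp add: has_parity_def)

lemma has_parity_add: "has_parity e P \<Longrightarrow> has_parity e Q \<Longrightarrow> has_parity e (P + Q)"
  by (simp add: has_parity_def)

lemma has_parity_smult: "has_parity e P \<Longrightarrow> has_parity e (Polynomial.smult u P)"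
  by (simp add: has_parity_def)

text \<open>Each part of the derivation shifts the degree in x by one: group elements gain a factor
  x, and a factor x is replaced by \<open>lam\<close>.\<close>

lemma has_parity_delta: "has_parity e P \<Longrightarrow> has_parity (\<not> e) (comm_deriv lam P)"
proof (induction P arbitrary: e)
  case (pCons u P)
  then have P: "e \<or> u = 0" "has_parity (\<not> e) P" by (simp_all add: has_parity_pCons)
  have "has_parity (\<not> e) (pCons 0 (comm_deriv lam P))"
    using pCons.IH[OF P(2)] by (simp add: has_parity_pCons)
  moreover have "has_parity (\<not> e) [:0, weight_deriv u:]"
    using P(1) by (auto simp: has_parity_pCons has_parity_0)
  ultimately show ?case
    unfolding comm_deriv_pCons by (intro has_parity_add has_parity_smult P(2))
qed (simp add: has_parity_0)

lemma has_parity_funpow_delta: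
  "has_parity e P \<Longrightarrow> has_parity (e = even n) ((comm_deriv lam ^^ n) P)"
proof (induction n)
  case (Suc n)
  then have "has_parity (e = even n) ((comm_deriv lam ^^ n) P)" by blast
  from has_parity_delta[OF this] show ?case by (cases e; cases "even n") simp_all
qed simp

text \<open>An odd number of derivations makes a group element odd in x, and the point at \<alpha> =
  0 sees only the constant term.\<close>

lemma T_odd_ggen:
  assumes "\<alpha> = 0" "odd n"
  shows "T n (ggen a) = 0"
proof -
  have "has_parity True (ggen a)"
    by (simp add: has_parity_pCons has_parity_0)
  from has_parity_funpow_delta[OF this, of n] assms(2)
  have "coeff ((comm_deriv lam ^^ n) (ggen a)) 0 = 0"
    by (simp add: has_parity_def)
  then show ?thesis
    unfolding T_def by (cases "(comm_deriv lam ^^ n) (ggen a)") (simp add: assms(1))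
qed

section \<open>The critical exponent in the four cases\<close>

lemma criticalI:
  assumes "\<And>b. (\<And>P. (\<Sum>j<s. b j * Dp j P) = 0) \<Longrightarrow> \<forall>j<s. b j = 0"
    and "j0 \<le> s" "b0 j0 \<noteq> 0" "\<And>P. (\<Sum>j\<le>s. b0 j * Dp j P) = 0"
  shows "critical s"
  using assms unfolding critical_def CHAR_alg_closure by (intro conjI) auto

text \<open>\<open>T 1\<close> itself is zero: its value at x is \<open>aug lam\<close>, and on
  group elements it vanishes by parity. Independence below 0 is empty.\<close>

lemma critical_0:
  assumes "\<alpha> = 0" "aug lam = 0"
  shows "critical 0"
proof -
  have xgen: "T 1 xgen = 0"
    using assms(2) by (simp add: T_Suc)
  have ggen: "T 1 (ggen a) = 0" for a
    by (rule T_odd_ggen[OF assms(1)]) simp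
  have "(\<Sum>j\<in>{..0}. 1 * Dp j P) = 0" for P
    by (rule Dp_combination_eq_0[of "\<lambda>_. 1"]) (use xgen ggen in simp_all)
  then show ?thesis
    by (rule criticalI[of _ 0 "\<lambda>_. 1", rotated 3]) simp_all
qed

text \<open>\<open>T 1\<close> and \<open>T p\<close> both vanish on group elements, since 1 and p
  are odd, and \<open>T 1\<close> has the nonzero value \<open>aug lam\<close> at x. So
  \<open>T p\<close> is a multiple of the nonzero \<open>T 1\<close>.\<close>

lemma critical_1:
  assumes "\<alpha> = 0" "aug lam \<noteq> 0" "odd CHAR('f)"
  shows "critical 1"
proof -
  have D0: "Dp 0 xgen = aug lam"
    by (simp add: T_Suc)
  define b where "b j = (if j = 0 then - Dp 1 xgen / aug lam else 1)" for j :: nat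
  have two: "(\<Sum>j\<in>{..1::nat}. f j) = f 0 + f 1" for f :: "nat \<Rightarrow> 'f alg_closure"
    by simp
  have rel: "(\<Sum>j\<in>{..1}. b j * Dp j P) = 0" for P
  proof (rule Dp_combination_eq_0)
    show "(\<Sum>j\<in>{..1}. b j * Dp j xgen) = 0"
      unfolding two D0 using assms(2) by (simp add: b_def)
    have "Dp j (ggen a) = 0" for j a
      using assms(1) by (rule T_odd_ggen) (use assms(3) in simp)
    then show "(\<Sum>j\<in>{..1}. b j * Dp j (ggen a)) = 0" for a
      by (simp only: two mult_zero_right add_0_left)
  qed
  have "b' 0 = 0" if "\<And>P. (\<Sum>j<1. b' j * Dp j P) = 0" for b' :: "nat \<Rightarrow> 'f alg_closure"
  proof -
    have "b' 0 * Dp 0 xgen = 0" using that[of xgen] by simp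
    then show ?thesis using assms(2) unfolding D0 by simp
  qed
  then have indep: "\<forall>j<1. b' j = 0" if "\<And>P. (\<Sum>j<1. b' j * Dp j P) = 0" for b' :: "nat \<Rightarrow> 'f alg_closure"
    using that by simp
  show ?thesis
    by (rule criticalI[of 1 1 b, OF indep _ _ rel]) (simp_all add: b_def)
qed

lemma Dp_combination_ggen_eq_0:
  assumes "CARD('f) = CHAR('f) ^ r" "range (\<lambda>n::nat. \<xi> ^ n) = UNIV - {0 :: 'f}"
    and "\<And>i. i < r \<Longrightarrow> (\<Sum>j\<in>B. b j * Dp j (ggen (\<xi> ^ i))) = 0"
  shows "(\<Sum>j\<in>B. b j * Dp j (ggen a)) = 0"
proof -
  define F where "F a = (\<Sum>j\<in>B. b j * Dp j (ggen a))" for a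
  have F_add: "F (a + a') = F a + F a'" for a a'
    unfolding F_def by (rule Dp_combination_ggen_add)
  have "{a. F a = 0} = UNIV"
  proof (rule power_sum_generators[OF prime_CHAR assms(1,2)])
    show "0 \<in> {a. F a = 0}"
      using F_add[of 0 0] by (simp only: add_0_left add_cancel_right_right mem_Collect_eq)
    show "a + a' \<in> {a. F a = 0}" if "a \<in> {a. F a = 0}" "a' \<in> {a. F a = 0}" for a a'
      using that by (simp add: F_add)
    show "\<xi> ^ i \<in> {a. F a = 0}" if "i < r" for i
      using assms(3)[OF that] by (simp add: F_def)
  qed
  then show ?thesis by (auto simp: F_def)
qed

text \<open>Vanishing on E costs r equations, one fewer than the unknowns. Vanishing at x then comes
  for free: \<open>zelt\<close> has derivative zero when c_0 = 0, and
  \<open>Dp_combination_zelt\<close> with 2 \<alpha> nonzero transfers this to x.\<close>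

lemma critical_t0:
  assumes "\<alpha> \<noteq> 0" "Poly_Mapping.lookup lam 0 = 0" "odd CHAR('f)"
    and "CARD('f) = CHAR('f) ^ r" "range (\<lambda>n::nat. \<xi> ^ n) = UNIV - {0 :: 'f}"
  shows "critical r"
proof -
  obtain b j0 where b: "j0 \<le> r" "b j0 \<noteq> 0" and rel: "\<And>i. i < r \<Longrightarrow> (\<Sum>j\<le>r. b j * Dp j (ggen (\<xi> ^ i))) = 0"
    by (rule nontrivial_relation[of r "\<lambda>i j. Dp j (ggen (\<xi> ^ i))"]) (rule that)
  have G: "(\<Sum>j\<le>r. b j * Dp j (ggen a)) = 0" for a
    by (rule Dp_combination_ggen_eq_0[OF assms(4,5) rel])
  have "(\<Sum>j\<le>r. b j * Dp j zelt) = 0"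
    by (simp add: Dp_zelt assms(2))
  then have "(\<Sum>j\<le>r. b j * Dp j xgen) = 0"
    using Dp_combination_zelt[of b "{..r}"] G assms(1) two_nonzero[OF assms(3)] by simp
  then have rel: "(\<Sum>j\<le>r. b j * Dp j P) = 0" for P
    using G by (rule Dp_combination_eq_0)
  have "\<forall>j<r. b' j = 0" if "\<And>P. (\<Sum>j<r. b' j * Dp j P) = 0" for b'
    by (rule Dp_independent[OF assms(1,4)]) (rule that)
  then show ?thesis
    using b rel by (rule criticalI)
qed

text \<open>For c_0 = 1 the condition at x is no longer automatic, so a relation is found only with
  r + 2 unknowns. Independence up to exponent r has to get past degree q, where polynomials in a are
  no longer determined by their values.\<close>

lemma critical_t1:
  assumes "\<alpha> \<noteq> 0" "Poly_Mapping.lookup lam 0 = 1" "odd CHAR('f)"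
    and card: "CARD('f) = CHAR('f) ^ r" and \<xi>: "range (\<lambda>n::nat. \<xi> ^ n) = UNIV - {0 :: 'f}" and "r \<ge> 1"
  shows "critical (Suc r)"
proof -
  let ?q = "CARD('f)"
  have "\<forall>j<Suc r. b j = 0" if b: "\<And>P. (\<Sum>j<Suc r. b j * Dp j P) = 0" for b
  proof -
    let ?P = "\<Sum>j<r. Polynomial.smult (b j) (gpoly (CHAR('f) ^ j))"
    \<comment> \<open>Reduction modulo a^q - a: the values on the finite field are unchanged, and
      the term of degree q cancels.\<close>
    define Q where "Q = ?P + Polynomial.smult (b r) (gpoly ?q) - Polynomial.smult (b r * \<alpha> ^ ?q) (monom 1 ?q - monom 1 1)"
    have q1: "?q > 1" using card one_less_power[OF prime_gt_1_nat[OF prime_CHAR], of r] assms(6) by simp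
    have "Q = 0"
    proof (rule poly_vanishing_on_finite_field)
      have Pq: "degree ?P < ?q" using degree_gpoly_combination[of b r] card by simp
      have "coeff Q i = 0" if "?q - 1 < i" for i
      proof (cases "i = ?q")
        case True
        then show ?thesis using Pq q1 by (simp add: Q_def coeff_eq_0 coeff_gpoly_top)
      next
        case False
        then have "?q < i" using that by simp
        then show ?thesis using Pq q1 by (simp add: Q_def coeff_eq_0 coeff_gpoly gcoef_eq_0)
      qed
      then have "degree Q \<le> ?q - 1" by (intro degree_le) simp
      then show "degree Q < ?q" using q1 by linarith
      fix a
      have "poly (?P + Polynomial.smult (b r) (gpoly ?q)) (to_ac a) = 0"
        using b[of "ggen a"] by (simp only: Dp_ggen_sum) (simp add: card)
      moreover have "to_ac a ^ ?q = to_ac a"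
        using finite_field_power_card[of a] by (metis to_ac_power)
      ultimately show "poly Q (to_ac a) = 0"
        by (simp add: Q_def poly_monom)
    qed
    \<comment> \<open>The reduction adds \<open>b r * \<alpha> ^ ?q\<close> to the linear
      coefficient. The rest of that coefficient is half of the relation evaluated at
      \<open>zelt\<close>, hence zero, which leaves \<open>b r = 0\<close>.\<close>
    then have "coeff Q 1 = 0" by simp
    moreover have "coeff (gpoly (CHAR('f) ^ j)) (Suc 0) = T (CHAR('f) ^ j - 1) xgen" for j
      using coeff_gpoly_1[of "CHAR('f) ^ j"] prime_gt_0_nat[OF prime_CHAR] by simp
    ultimately have "(\<Sum>j<Suc r. b j * T (CHAR('f) ^ j - 1) xgen) + b r * \<alpha> ^ ?q = 0"
      using q1 assms(6) by (simp add: Q_def coeff_sum card)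
    moreover have "(\<Sum>j<Suc r. b j * T (CHAR('f) ^ j - 1) xgen) = 0"
    proof -
      have "2 * (\<Sum>j<Suc r. b j * T (CHAR('f) ^ j - 1) xgen) = (\<Sum>j<Suc r. b j * Dp j zelt)"
        unfolding Dp_zelt assms(2) sum_distrib_left by (simp add: mult_ac)
      also have "\<dots> = 0" by (rule b)
      finally show ?thesis using two_nonzero[OF assms(3)] unfolding mult_eq_0_iff by blast
    qed
    ultimately have "b r = 0" using assms(1) by simp
    moreover from this have "\<forall>j<r. b j = 0"
      using b by (intro Dp_independent[OF assms(1) card]) simp
    ultimately show ?thesis by (auto simp: less_Suc_eq)
  qed
  note indep = this
  \<comment> \<open>Index r stands for the condition at x, the smaller indices for the generators of
    E.\<close>
  obtain b j0 where b: "j0 \<le> Suc r" "b j0 \<noteq> 0"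
    and rel: "\<And>i. i < Suc r \<Longrightarrow> (\<Sum>j\<le>Suc r. b j * Dp j (if i = r then xgen else ggen (\<xi> ^ i))) = 0"
    by (rule nontrivial_relation[of "Suc r" "\<lambda>i j. Dp j (if i = r then xgen else ggen (\<xi> ^ i))"]) (rule that)
  have "(\<Sum>j\<le>Suc r. b j * Dp j (ggen (\<xi> ^ i))) = 0" if "i < r" for i
    using rel[of i] that by simp
  then have "(\<Sum>j\<le>Suc r. b j * Dp j (ggen a)) = 0" for a
    by (rule Dp_combination_ggen_eq_0[OF card \<xi>])
  moreover have "(\<Sum>j\<le>Suc r. b j * Dp j xgen) = 0"
    using rel[of r] by simp
  ultimately have "(\<Sum>j\<le>Suc r. b j * Dp j P) = 0" for P
    by (rule Dp_combination_eq_0[rotated])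
  with indep b show ?thesis by (rule criticalI)
qed

end

section \<open>The radical of \<open>kE\<close>\<close>

lemma CHAR_group_alg: "CHAR('f::{finite,field} group_alg) = CHAR('f)"
proof (rule CHAR_eqI)
  have *: "of_nat n = (Poly_Mapping.single 0 (of_nat n) :: 'f group_alg)" for n
    by (induction n) (simp_all add: single_add)
  show "of_nat CHAR('f) = (0 :: 'f group_alg)"
    unfolding * by (metis CHAR_alg_closure of_nat_CHAR single_zero)
  show "CHAR('f) dvd n" if "of_nat n = (0 :: 'f group_alg)" for n
  proof -
    have "of_nat n = (0 :: 'f alg_closure)"
      using that unfolding * by (metis lookup_single_eq lookup_zero)
    then show ?thesis by (simp add: of_nat_eq_0_iff_char_dvd)
  qed
qed

text \<open>Frobenius is additive on kE and sends each group element to the identity, because E has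
  exponent p.\<close>

lemma power_CHAR_group_alg:
  fixes u :: "'f::{finite,field} group_alg"
  shows "u ^ CHAR('f) = Poly_Mapping.single 0 (aug u ^ CHAR('f))"
proof -
  note p = prime_CHAR_finite[where ?'f = 'f]
  have single: "Poly_Mapping.single a c ^ n = Poly_Mapping.single (of_nat n * a) (c ^ n)"
    for a :: 'f and c :: "'f alg_closure" and n
    by (induction n) (simp_all add: mult_single algebra_simps)
  have "u = (\<Sum>a\<in>UNIV. Poly_Mapping.single a (Poly_Mapping.lookup u a))"
    by (rule poly_mapping_eqI) (simp add: lookup_sum lookup_single when_def)
  then have "u ^ CHAR('f) = (\<Sum>a\<in>UNIV. Poly_Mapping.single a (Poly_Mapping.lookup u a)) ^ CHAR('f)"
    by simp
  also have "\<dots> = (\<Sum>a\<in>UNIV. Poly_Mapping.single a (Poly_Mapping.lookup u a) ^ CHAR('f))"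
    using p by (intro freshmans_dream_sum) (simp_all add: CHAR_group_alg)
  also have "\<dots> = (\<Sum>a\<in>UNIV. Poly_Mapping.single 0 (Poly_Mapping.lookup u a ^ CHAR('f)))"
    by (simp add: single)
  also have "\<dots> = Poly_Mapping.single 0 (\<Sum>a\<in>UNIV. Poly_Mapping.lookup u a ^ CHAR('f))"
    by (rule poly_mapping_eqI) (simp add: lookup_sum lookup_single when_def)
  also have "(\<Sum>a\<in>UNIV. Poly_Mapping.lookup u a ^ CHAR('f)) = aug u ^ CHAR('f)"
    unfolding aug_def using p by (intro freshmans_dream_sum[symmetric]) simp_all
  finally show ?thesis .
qed

lemma aug_uminus: "aug (- u) = - aug u"
  using aug_add[of u "- u"] by (simp add: eq_neg_iff_add_eq_0 add.commute)

text \<open>An element outside the kernel can be scaled to some w of augmentation 1. Then 1 - w lies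
  in the kernel, so a larger ideal contains 1.\<close>

lemma maximalideal_aug_kernel:
  "maximalideal {u :: 'f::{finite,field} group_alg. aug u = 0} ring_of_type_algebra"
proof -
  let ?R = "ring_of_type_algebra :: 'f group_alg ring"
  let ?I = "{u :: 'f group_alg. aug u = 0}"
  interpret R: cring ?R by (rule cring_from_type_algebra)
  have R_simps: "carrier ?R = UNIV" "add ?R = (+)" "mult ?R = (*)" "zero ?R = 0" "one ?R = 1"
    by (simp_all add: ring_of_type_algebra_def fun_eq_iff)
  have minus: "inv\<^bsub>add_monoid ?R\<^esub> u = - u" for u
  proof -
    have "\<ominus>\<^bsub>?R\<^esub> u = - u"
      by (rule R.minus_equality) (simp_all add: R_simps)
    then show ?thesis by (simp add: a_inv_def)
  qed
  show ?thesis
  proof (rule maximalidealI)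
    have "subgroup ?I (add_monoid ?R)"
    proof (rule subgroup.intro)
      show "inv\<^bsub>add_monoid ?R\<^esub> u \<in> ?I" if "u \<in> ?I" for u
        unfolding minus using that by (simp add: aug_uminus)
    qed (simp_all add: R_simps aug_add)
    then show "ideal ?I ?R"
      by (rule idealI[OF R.ring_axioms]) (simp_all add: R_simps aug_mult)
    show "carrier ?R \<noteq> ?I"
    proof
      assume "carrier ?R = ?I"
      then have "(1 :: 'f group_alg) \<in> ?I" by (simp add: R_simps set_eq_iff)
      then show False by simp
    qed
    fix J assume J: "ideal J ?R" "?I \<subseteq> J" "J \<subseteq> carrier ?R"
    interpret J: ideal J ?R by (rule J(1))
    show "J = ?I \<or> J = carrier ?R"
    proof (cases "J \<subseteq> ?I")
      case True
      then show ?thesis using J by auto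
    next
      case False
      then obtain u where u: "u \<in> J" "aug u \<noteq> 0" by blast
      define w where "w = Poly_Mapping.single 0 (inverse (aug u)) * u"
      have "w \<in> J" using J.I_l_closed[OF u(1), of "Poly_Mapping.single 0 (inverse (aug u))"]
        by (simp add: R_simps w_def)
      moreover have "1 - w \<in> J"
      proof -
        have "aug (1 - w) = 0" using u(2) by (simp add: aug_add aug_uminus aug_mult w_def diff_conv_add_uminus del: add_uminus_conv_diff)
        then show ?thesis using J(2) by auto
      qed
      ultimately have "w + (1 - w) \<in> J" using J.a_closed[of w "1 - w"] by (simp only: R_simps)
      then have "\<one>\<^bsub>?R\<^esub> \<in> J" by (simp add: R_simps)
      then show ?thesis using J.one_imp_carrier by simp
    qed
  qed
qed

text \<open>The augmentation ideal is maximal, which gives one direction. Conversely, an element of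
  augmentation 0 is nilpotent and so lies in every prime ideal.\<close>

lemma jacobson_radical_group_alg:
  "lam \<in> jacobson_radical (ring_of_type_algebra :: 'f::{finite,field} group_alg ring) \<longleftrightarrow> aug lam = 0"
proof
  assume "lam \<in> jacobson_radical (ring_of_type_algebra :: 'f group_alg ring)"
  then show "aug lam = 0"
    using maximalideal_aug_kernel unfolding jacobson_radical_def by blast
next
  let ?R = "ring_of_type_algebra :: 'f group_alg ring"
  assume "aug lam = 0"
  moreover have p: "prime CHAR('f)" by (rule prime_CHAR_finite)
  moreover from this have "CHAR('f) > 0" by (rule prime_gt_0_nat)
  ultimately have nilp: "lam ^ CHAR('f) = 0"
    by (simp add: power_CHAR_group_alg zero_power)
  have "lam \<in> M" if "maximalideal M ?R" for M
  proof -
    have R_simps: "carrier ?R = UNIV" "add ?R = (+)" "mult ?R = (*)" "zero ?R = 0" "one ?R = 1"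
      by (simp_all add: ring_of_type_algebra_def fun_eq_iff)
    interpret R: cring ?R by (rule cring_from_type_algebra)
    interpret M: primeideal M ?R by (rule R.maximalideal_prime[OF that])
    have "lam ^ n \<in> M \<Longrightarrow> n > 0 \<Longrightarrow> lam \<in> M" for n
    proof (induction n)
      case (Suc n)
      show ?case
      proof (cases "n = 0")
        case False
        have "lam \<otimes>\<^bsub>?R\<^esub> lam ^ n \<in> M" using Suc.prems by (simp add: R_simps)
        then have "lam \<in> M \<or> lam ^ n \<in> M"
          by (intro M.I_prime) (simp_all add: R_simps)
        then show ?thesis using Suc.IH False by auto
      qed (use Suc.prems in simp)
    qed simp
    moreover have "lam ^ CHAR('f) \<in> M"
      using M.zero_closed by (simp add: nilp R_simps)
    ultimately show ?thesis using p by (simp add: prime_gt_0_nat)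
  qed
  then show "lam \<in> jacobson_radical ?R"
    by (auto simp: jacobson_radical_def ring_of_type_algebra_def)
qed

section \<open>Simple modules as quotients of \<open>k[y]\<close>\<close>

lemma of_free_simps:
  "of_free (f + g) = of_free f + of_free g"
  "smash_mult (of_free f) (of_free g) = of_free (f * g)"
  by (simp_all add: of_free_def single_add)

lemma lookup_of_group_alg: "Poly_Mapping.lookup (of_group_alg u) a = fconst (Poly_Mapping.lookup u a)"
  by (simp add: of_group_alg_def Poly_Mapping.map.rep_eq when_def)

lemma of_group_alg_single: "of_group_alg (Poly_Mapping.single a c) = Poly_Mapping.single a (fconst c)"
  by (rule poly_mapping_eqI) (simp add: lookup_of_group_alg lookup_single when_def)

lemma of_group_alg_add: "of_group_alg (u + w) = of_group_alg u + of_group_alg w"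
  by (rule poly_mapping_eqI) (simp add: lookup_of_group_alg lookup_add)

lemma of_group_alg_0 [simp]: "of_group_alg 0 = 0"
  using of_group_alg_single[of 0 0] by simp

lemma smash_mult_0 [simp]: "smash_mult 0 P = 0" "smash_mult P 0 = 0"
  by (simp_all add: smash_mult_def)

lemma of_group_alg_mult: "of_group_alg (u * w) = smash_mult (of_group_alg u) (of_group_alg w)"
proof (induction u rule: poly_mapping_single_add_induct)
  case (single a c)
  show ?case
    by (induction w rule: poly_mapping_single_add_induct)
      (simp_all add: mult_single of_group_alg_single of_group_alg_add smash_mult_add_right distrib_left)
qed (simp add: of_group_alg_add smash_mult_add_left distrib_right)

lemma of_group_alg_x:
  "smash_mult (of_group_alg u) (of_free (fgen Lx)) = smash_mult (of_free (fgen Lx)) (of_group_alg u)"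
  by (induction u rule: poly_mapping_single_add_induct)
    (simp_all add: of_group_alg_single of_group_alg_add of_free_def smash_mult_add_left smash_mult_add_right
      fconst_commute[of _ "fgen Lx"])

lemma of_group_alg_y:
  "smash_mult (of_group_alg u) (of_free (fgen Ly)) = smash_mult (of_free (fgen Ly)) (of_group_alg u) +
     smash_mult (of_free (fgen Lx)) (of_group_alg (weight_deriv u))"
proof (induction u rule: poly_mapping_single_add_induct)
  case (single a c)
  have "fconst c * (fconst (to_ac a) * fgen Lx) = fconst (c * to_ac a) * fgen Lx"
    by (simp add: mult.assoc)
  also have "\<dots> = fgen Lx * fconst (to_ac a * c)"
    by (simp only: fconst_commute[of _ "fgen Lx"] mult.commute[of c])
  finally have "fconst c * (fconst (to_ac a) * fgen Lx) = fgen Lx * fconst (to_ac a * c)" .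
  then have "fconst c * (fgen Ly + fconst (to_ac a) * fgen Lx) = fgen Ly * fconst c + fgen Lx * fconst (to_ac a * c)"
    by (simp only: distrib_left fconst_commute[of c "fgen Ly"])
  then show ?case
    by (simp add: of_group_alg_single of_free_def single_add[symmetric] del: fconst_simps)
qed (simp add: of_group_alg_add smash_mult_add_left smash_mult_add_right weight_deriv_add ac_simps)

lemma of_free_fconst: "of_free (fconst c) = of_group_alg (Poly_Mapping.single 0 c)"
  by (simp add: of_group_alg_single of_free_def)

text \<open>x commutes with kE already in the smash product, so commutative polynomials over kE can
  be used here; only the commutator with y involves the relation of \<open>H_alg\<close>.\<close>

definition x_embed :: "'f::{finite,field} group_alg poly \<Rightarrow> 'f smash" where
  "x_embed P = fold_coeffs (\<lambda>u Q. of_group_alg u + smash_mult (of_free (fgen Lx)) Q) P 0"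

lemma x_embed_0 [simp]: "x_embed 0 = 0"
  by (simp add: x_embed_def)

lemma x_embed_pCons: "x_embed (pCons u P) = of_group_alg u + smash_mult (of_free (fgen Lx)) (x_embed P)"
  unfolding x_embed_def by (subst fold_coeffs_pCons') simp_all

lemma x_embed_add: "x_embed (P + Q) = x_embed P + x_embed Q"
  by (induction P Q rule: poly_induct2)
    (simp_all add: x_embed_pCons of_group_alg_add smash_mult_add_right algebra_simps)

lemma x_embed_smult: "x_embed (Polynomial.smult u P) = smash_mult (of_group_alg u) (x_embed P)"
  by (induction P)
    (simp_all add: x_embed_pCons of_group_alg_mult smash_mult_add_right of_group_alg_x
      flip: smash_mult_assoc)

definition y_embed :: "'f::{finite,field} alg_closure poly \<Rightarrow> 'f smash" where
  "y_embed m = fold_coeffs (\<lambda>c Q. of_free (fconst c) + smash_mult (of_free (fgen Ly)) Q) m 0"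

lemma y_embed_0 [simp]: "y_embed 0 = 0"
  by (simp add: y_embed_def)

lemma y_embed_pCons: "y_embed (pCons c m) = of_free (fconst c) + smash_mult (of_free (fgen Ly)) (y_embed m)"
  unfolding y_embed_def by (subst fold_coeffs_pCons') (simp_all add: of_free_def)

lemma y_embed_add: "y_embed (m + n) = y_embed m + y_embed n"
  by (induction m n rule: poly_induct2)
    (simp_all add: y_embed_pCons of_free_simps smash_mult_add_right algebra_simps)

lemma y_embed_smult: "y_embed (Polynomial.smult c m) = smash_mult (of_free (fconst c)) (y_embed m)"
proof (induction m)
  case (pCons d m)
  have "smash_mult (of_free (fconst c)) (of_free (fgen Ly)) = smash_mult (of_free (fgen Ly)) (of_free (fconst c))"
    by (simp add: of_free_simps fconst_commute[of c "fgen Ly"])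
  then show ?case
    using pCons by (simp add: y_embed_pCons of_free_simps smash_mult_add_right flip: smash_mult_assoc)
qed simp

lemma y_embed_mult: "y_embed (m * n) = smash_mult (y_embed m) (y_embed n)"
  by (induction m)
    (simp_all add: y_embed_pCons y_embed_add y_embed_smult smash_mult_add_left smash_mult_assoc of_free_def[of 0])

section \<open>The action of the smash product on a module\<close>

locale H_module = crossed_data lam \<alpha> + V: left_module "H_alg lam" V
  for lam :: "'f::{finite,field} group_alg" and \<alpha> and V :: "('f smash set, 'v) module"
begin

text \<open>The action is pulled back to the smash product, so that computations use representatives
  instead of cosets.\<close>

definition rho :: "'f smash \<Rightarrow> 'v \<Rightarrow> 'v" where
  "rho P u = H_class lam P \<odot>\<^bsub>V\<^esub> u"

lemma H_class_closed: "H_class lam P \<in> carrier (H_alg lam)"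
  using H_class_hom[of lam] by (auto simp: ring_hom_def smash_ring_def)

lemma rho_closed [simp]: "u \<in> carrier V \<Longrightarrow> rho P u \<in> carrier V"
  unfolding rho_def by (intro V.smult_closed H_class_closed)

lemma rho_add_left: "u \<in> carrier V \<Longrightarrow> rho (P + Q) u = rho P u \<oplus>\<^bsub>V\<^esub> rho Q u"
  using ring_hom_add[OF H_class_hom, of P Q lam]
  by (simp add: rho_def smash_ring_def V.smult_l_distr H_class_closed)

lemma rho_add_right: "u \<in> carrier V \<Longrightarrow> w \<in> carrier V \<Longrightarrow> rho P (u \<oplus>\<^bsub>V\<^esub> w) = rho P u \<oplus>\<^bsub>V\<^esub> rho P w"
  by (simp add: rho_def V.smult_r_distr H_class_closed)

lemma rho_mult: "u \<in> carrier V \<Longrightarrow> rho (smash_mult P Q) u = rho P (rho Q u)"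
  using ring_hom_mult[OF H_class_hom, of P Q lam]
  by (simp add: rho_def smash_ring_def V.smult_assoc H_class_closed)

lemma rho_one: "u \<in> carrier V \<Longrightarrow> rho (Poly_Mapping.single 0 1) u = u"
  using ring_hom_one[OF H_class_hom, of lam]
  by (simp add: rho_def smash_ring_def V.smult_one del: single_one)

lemma rho_0 [simp]: "u \<in> carrier V \<Longrightarrow> rho 0 u = \<zero>\<^bsub>V\<^esub>"
  using rho_add_left[of u 0 0] V.M.add.l_cancel_one'[of "rho 0 u" "rho 0 u"] by simp

lemma rho_zero [simp]: "rho P \<zero>\<^bsub>V\<^esub> = \<zero>\<^bsub>V\<^esub>"
  using rho_add_right[of "\<zero>\<^bsub>V\<^esub>" "\<zero>\<^bsub>V\<^esub>" P] V.M.add.l_cancel_one'[of "rho P \<zero>\<^bsub>V\<^esub>" "rho P \<zero>\<^bsub>V\<^esub>"] by simp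

lemma rho_minus: "u \<in> carrier V \<Longrightarrow> rho (- P) u = \<ominus>\<^bsub>V\<^esub> rho P u"
  using rho_add_left[of u "- P" P] by (intro V.M.minus_equality[symmetric]) simp_all

lemma rho_H_ideal:
  assumes "P \<in> H_ideal lam" "u \<in> carrier V"
  shows "rho P u = \<zero>\<^bsub>V\<^esub>"
proof -
  interpret I: ideal "H_ideal lam" smash_ring by (rule ideal_H_ideal)
  have "H_class lam P = H_class lam 0"
    unfolding H_class_def
    using I.a_rcos_const[OF assms(1)] I.a_rcos_const[OF additive_subgroup.zero_closed[OF I.is_additive_subgroup]] by (simp add: smash_ring_def)
  then show ?thesis using rho_0[OF assms(2)] by (simp add: rho_def)
qed

abbreviation rX :: "'v \<Rightarrow> 'v" where "rX \<equiv> rho (of_free (fgen Lx))"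
abbreviation rY :: "'v \<Rightarrow> 'v" where "rY \<equiv> rho (of_free (fgen Ly))"
abbreviation rU :: "'f group_alg \<Rightarrow> 'v \<Rightarrow> 'v" where "rU w \<equiv> rho (of_group_alg w)"
abbreviation rK :: "'f alg_closure \<Rightarrow> 'v \<Rightarrow> 'v" where "rK c \<equiv> rho (of_free (fconst c))"

lemma rho_xy:
  assumes u: "u \<in> carrier V"
  shows "rX (rY u) = rY (rX u) \<oplus>\<^bsub>V\<^esub> rU lam u"
proof -
  let ?d = "of_free (fgen Lx * fgen Ly - fgen Ly * fgen Lx) - of_group_alg lam"
  have "?d \<in> H_ideal lam"
    unfolding H_ideal_def by (rule ring.genideal_self'[OF ring_smash_ring]) (simp add: smash_ring_def)
  then have d: "rho ?d u = \<zero>\<^bsub>V\<^esub>" using u by (rule rho_H_ideal)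
  have "of_free (fgen Lx * fgen Ly) = ?d + (of_free (fgen Ly * fgen Lx) + of_group_alg lam)"
    by (simp add: of_free_def single_diff)
  then have "rho (of_free (fgen Lx * fgen Ly)) u = rho (of_free (fgen Ly * fgen Lx)) u \<oplus>\<^bsub>V\<^esub> rU lam u"
    using u d by (simp only: rho_add_left V.M.l_zero rho_closed V.M.add.m_closed)
  then show ?thesis using u by (simp flip: of_free_simps(2) add: rho_mult)
qed

lemma rho_ux: "u \<in> carrier V \<Longrightarrow> rU w (rX u) = rX (rU w u)"
  by (simp add: of_group_alg_x flip: rho_mult)

lemma rho_uy: "u \<in> carrier V \<Longrightarrow> rU w (rY u) = rY (rU w u) \<oplus>\<^bsub>V\<^esub> rX (rU (weight_deriv w) u)"
  by (simp add: of_group_alg_y rho_add_left flip: rho_mult)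

text \<open>Moving the coefficient \<open>w\<close> past y creates the weight term, and moving x
  past y creates the \<open>lam\<close> term; together they are the recursion of
  \<open>comm_deriv\<close>.\<close>

lemma rho_commutator:
  assumes "u \<in> carrier V"
  shows "rho (x_embed P) (rY u) = rY (rho (x_embed P) u) \<oplus>\<^bsub>V\<^esub> rho (x_embed (comm_deriv lam P)) u"
proof (induction P)
  case (pCons w P)
  note [simp] = assms
  let ?A = "rY (rU w u)" and ?B = "rX (rU (weight_deriv w) u)"
    and ?C = "rY (rX (rho (x_embed P) u))" and ?D = "rU lam (rho (x_embed P) u)"
    and ?E = "rX (rho (x_embed (comm_deriv lam P)) u)"
  have "rho (x_embed (pCons w P)) (rY u) = rU w (rY u) \<oplus>\<^bsub>V\<^esub> rX (rho (x_embed P) (rY u))"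
    by (simp add: x_embed_pCons rho_add_left rho_mult)
  also have "\<dots> = (?A \<oplus>\<^bsub>V\<^esub> ?B) \<oplus>\<^bsub>V\<^esub> ((?C \<oplus>\<^bsub>V\<^esub> ?D) \<oplus>\<^bsub>V\<^esub> ?E)"
    by (simp add: rho_uy pCons.IH rho_add_right rho_xy)
  also have "\<dots> = (?A \<oplus>\<^bsub>V\<^esub> ?C) \<oplus>\<^bsub>V\<^esub> (?B \<oplus>\<^bsub>V\<^esub> ?D \<oplus>\<^bsub>V\<^esub> ?E)"
    by (simp add: V.M.a_ac)
  also have "?A \<oplus>\<^bsub>V\<^esub> ?C = rY (rho (x_embed (pCons w P)) u)"
    by (simp add: x_embed_pCons rho_add_left rho_mult rho_add_right)
  also have "?B \<oplus>\<^bsub>V\<^esub> ?D \<oplus>\<^bsub>V\<^esub> ?E = rho (x_embed (comm_deriv lam (pCons w P))) u"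
    unfolding comm_deriv_pCons x_embed_add
    by (simp add: x_embed_pCons x_embed_smult rho_add_left rho_mult)
  finally show ?case .
qed (simp add: assms)

lemma rho_x_const: "u \<in> carrier V \<Longrightarrow> rX (rK c u) = rK c (rX u)"
  by (simp add: of_free_fconst rho_ux)

lemma rho_x_embed_const:
  assumes "u \<in> carrier V"
  shows "rho (x_embed P) (rK c u) = rK c (rho (x_embed P) u)"
proof (induction P)
  case (pCons w P)
  have "rU w (rK c u) = rK c (rU w u)"
    using assms by (simp add: of_free_fconst mult.commute flip: rho_mult of_group_alg_mult)
  then show ?case
    using assms by (simp add: rho_x_const x_embed_pCons rho_add_left rho_mult rho_add_right pCons.IH)
qed (simp add: assms)

lemma rho_const_add: "u \<in> carrier V \<Longrightarrow> rK (c + d) u = rK c u \<oplus>\<^bsub>V\<^esub> rK d u"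
  by (simp add: of_free_simps rho_add_left)

lemma rho_const_mult: "u \<in> carrier V \<Longrightarrow> rK (c * d) u = rK c (rK d u)"
  by (simp flip: of_free_simps(2) add: rho_mult)

lemma rho_const_1: "u \<in> carrier V \<Longrightarrow> rK 1 u = u"
  using rho_one by (simp add: of_free_def)

text \<open>The algebra is generated by x, y and kE, with the scalars contained in kE. Stability
  therefore extends along words and then to sums.\<close>

lemma submoduleI:
  assumes N: "N \<subseteq> carrier V" "\<zero>\<^bsub>V\<^esub> \<in> N" "\<And>u w. u \<in> N \<Longrightarrow> w \<in> N \<Longrightarrow> u \<oplus>\<^bsub>V\<^esub> w \<in> N"
    and X: "\<And>u. u \<in> N \<Longrightarrow> rX u \<in> N" and Y: "\<And>u. u \<in> N \<Longrightarrow> rY u \<in> N"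
    and U: "\<And>w u. u \<in> N \<Longrightarrow> rU w u \<in> N"
  shows "Module.submodule N (H_alg lam) V"
proof -
  have free: "rho (of_free f) u \<in> N" if "u \<in> N" for f u
  proof (induction f rule: poly_mapping_single_add_induct)
    case (single w c)
    obtain ls where w: "w = Word ls" by (cases w)
    show ?case unfolding w
    proof (induction ls)
      case Nil
      have "of_free (Poly_Mapping.single (Word []) c) = of_group_alg (Poly_Mapping.single 0 c)"
        by (simp add: fconst_def zero_word_def flip: of_free_fconst)
      then show ?case using U that by simp
    next
      case (Cons l ls)
      have "of_free (Poly_Mapping.single (Word (l # ls)) c) =
          smash_mult (of_free (fgen l)) (of_free (Poly_Mapping.single (Word ls) c))"
        by (simp add: of_free_simps fgen_def mult_single plus_word_def)
      then have "rho (of_free (Poly_Mapping.single (Word (l # ls)) c)) u =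
          rho (of_free (fgen l)) (rho (of_free (Poly_Mapping.single (Word ls) c)) u)"
        using that N(1) by (simp add: rho_mult subset_iff)
      then show ?case using X Y Cons by (cases l) auto
    qed
  next
    case (add f g)
    then show ?case using that N by (simp add: of_free_simps rho_add_left subset_iff)
  qed
  have all: "rho P u \<in> N" if "u \<in> N" for P u
  proof (induction P rule: poly_mapping_single_add_induct)
    case (single g f)
    have "Poly_Mapping.single g f = smash_mult (of_free f) (of_group_alg (Poly_Mapping.single g 1))"
      by (simp add: of_free_def of_group_alg_single)
    then have "rho (Poly_Mapping.single g f) u = rho (of_free f) (rU (Poly_Mapping.single g 1) u)"
      using that N(1) by (simp only: rho_mult subset_iff)
    then show ?case using free U that by simp
  next
    case (add P Q)
    then show ?case using that N by (simp add: rho_add_left subset_iff)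
  qed
  have cls: "\<exists>P. h = H_class lam P" if "h \<in> carrier (H_alg lam)" for h
    using that by (auto simp: H_alg_def FactRing_def A_RCOSETS_def' H_class_def)
  show ?thesis
  proof (intro Module.submodule.intro Module.submodule_axioms.intro subgroup.intro)
    show "inv\<^bsub>add_monoid V\<^esub> u \<in> N" if "u \<in> N" for u
      using all[OF that, of "- Poly_Mapping.single 0 1"] that N(1)
      by (simp add: rho_minus rho_one subset_iff a_inv_def del: single_one)
    show "h \<odot>\<^bsub>V\<^esub> u \<in> N" if "h \<in> carrier (H_alg lam)" "u \<in> N" for h u
      using cls[OF that(1)] all[OF that(2)] by (auto simp: rho_def)
  qed (use N in auto)
qed

end

text \<open>Take the image v of the class of 1. It generates V, hence is nonzero, and it is killed
  by \<open>Delta_ideal\<close>.\<close>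

lemma (in H_module) quotient_generator:
  assumes quot: "is_quotient_of (H_alg lam) V (Delta lam \<xi> r \<alpha>)"
    and nontriv: "carrier V \<noteq> {\<zero>\<^bsub>V\<^esub>}"
    and card: "CARD('f) = CHAR('f) ^ r" and \<xi>: "range (\<lambda>n::nat. \<xi> ^ n) = UNIV - {0 :: 'f}"
  obtains v where "v \<in> carrier V" "v \<noteq> \<zero>\<^bsub>V\<^esub>" "rX v = rK \<alpha> v"
    "\<And>a. rU (Poly_Mapping.single a 1) v = v"
proof -
  let ?H = "H_alg lam" and ?M = "regular_module (H_alg lam)" and ?N = "Delta_ideal lam \<xi> r \<alpha>"
    and ?Q = "Delta lam \<xi> r \<alpha>"
  interpret M: left_module ?H ?M by (rule left_module_regular_module[OF ring_H_alg])
  interpret N: Module.submodule ?N ?H ?M by (rule submodule_Delta_ideal)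
  interpret N: abelian_subgroup ?N ?M
    by (intro abelian_subgroupI3 additive_subgroup.intro N.subgroup_axioms M.M.abelian_group_axioms)
  have M_simps: "carrier ?M = carrier ?H" "add ?M = add ?H" "zero ?M = zero ?H" "Module.smult ?M = mult ?H"
    by (simp_all add: regular_module_def)
  obtain h where h: "h \<in> module_hom ?H ?Q V" and surj: "h ` carrier ?Q = carrier V"
    using quot by (auto simp: is_quotient_of_def)
  define q where "q a = ?N +>\<^bsub>?M\<^esub> a" for a
  have q_carrier: "q a \<in> carrier ?Q" if "a \<in> carrier ?H" for a
    using that by (auto simp: q_def Delta_def quotient_module_def A_RCOSETS_def' M_simps)
  have q_all: "\<exists>a\<in>carrier ?H. C = q a" if "C \<in> carrier ?Q" for C
    using that by (auto simp: q_def Delta_def quotient_module_def A_RCOSETS_def' M_simps)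
  have q_smult: "b \<odot>\<^bsub>?Q\<^esub> q a = q (b \<otimes>\<^bsub>?H\<^esub> a)" if "a \<in> carrier ?H" "b \<in> carrier ?H" for a b
    using M.smult_coset[OF submodule_Delta_ideal that(2), of a] that(1)
    by (simp add: q_def Delta_def quotient_module_def M_simps)
  define v where "v = h (q \<one>\<^bsub>?H\<^esub>)"
  have v: "v \<in> carrier V"
    using surj q_carrier[OF V.R.one_closed] by (auto simp: v_def)
  have h_q: "h (q a) = a \<odot>\<^bsub>V\<^esub> v" if "a \<in> carrier ?H" for a
  proof -
    have "h (q a) = h (a \<odot>\<^bsub>?Q\<^esub> q \<one>\<^bsub>?H\<^esub>)"
      using that by (simp add: q_smult)
    also have "\<dots> = a \<odot>\<^bsub>V\<^esub> v"
      using h that q_carrier[OF V.R.one_closed] by (simp add: module_hom_def v_def)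
    finally show ?thesis .
  qed
  have v0: "v \<noteq> \<zero>\<^bsub>V\<^esub>"
  proof
    assume v_eq: "v = \<zero>\<^bsub>V\<^esub>"
    have "u = \<zero>\<^bsub>V\<^esub>" if u_in: "u \<in> carrier V" for u
    proof -
      from u_in obtain C where C: "C \<in> carrier ?Q" "u = h C"
        unfolding surj[symmetric] by blast
      obtain a where a: "a \<in> carrier ?H" "C = q a" using q_all[OF C(1)] by blast
      have "u = a \<odot>\<^bsub>V\<^esub> \<zero>\<^bsub>V\<^esub>" using C a h_q v_eq by simp
      also obtain P where "a = H_class lam P"
        using a(1) by (auto simp: H_alg_def FactRing_def A_RCOSETS_def' H_class_def)
      then have "a \<odot>\<^bsub>V\<^esub> \<zero>\<^bsub>V\<^esub> = \<zero>\<^bsub>V\<^esub>" using rho_zero[of P] by (simp add: rho_def)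
      finally show ?thesis .
    qed
    then show False using nontriv by auto
  qed
  have kill: "rho P v = \<zero>\<^bsub>V\<^esub>" if P: "H_class lam P \<in> ?N" for P
  proof -
    have "q (H_class lam P) = q \<zero>\<^bsub>?H\<^esub>"
      using N.a_rcos_const[OF P] N.a_rcos_const[OF N.zero_closed] by (simp add: q_def M_simps)
    then have "rho P v = \<zero>\<^bsub>?H\<^esub> \<odot>\<^bsub>V\<^esub> v"
      using h_q[OF H_class_closed, of P] h_q[OF V.R.zero_closed] by (simp add: rho_def)
    also have "\<zero>\<^bsub>?H\<^esub> = H_class lam 0"
      using ring_hom_zero[OF H_class_hom ring_smash_ring ring_H_alg, of lam] by (simp add: smash_ring_def)
    finally show ?thesis using rho_0[OF v] by (simp add: rho_def)
  qed
  have N_I: "b \<otimes>\<^bsub>?H\<^esub> H_class lam (of_free (fgen Lx - fconst \<alpha>)) \<oplus>\<^bsub>?H\<^esub>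
        (\<Oplus>\<^bsub>?H\<^esub> i\<in>{1..r}. c i \<otimes>\<^bsub>?H\<^esub> H_class lam (of_group (\<xi> ^ (i - 1)) - of_group 0)) \<in> ?N"
    if "b \<in> carrier ?H" "c \<in> {1..r} \<rightarrow> carrier ?H" for b c
    using that unfolding Delta_ideal_def by blast
  have "H_class lam (of_free (fgen Lx - fconst \<alpha>)) \<in> ?N"
  proof -
    have "(\<Oplus>\<^bsub>?H\<^esub> i\<in>{1..r}. \<zero>\<^bsub>?H\<^esub> \<otimes>\<^bsub>?H\<^esub> H_class lam (of_group (\<xi> ^ (i - 1)) - of_group 0)) = \<zero>\<^bsub>?H\<^esub>"
      by (simp add: H_class_closed)
    then show ?thesis
      using N_I[of "\<one>\<^bsub>?H\<^esub>" "\<lambda>_. \<zero>\<^bsub>?H\<^esub>"] by (simp add: H_class_closed)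
  qed
  then have "rho (of_free (fgen Lx - fconst \<alpha>)) v = \<zero>\<^bsub>V\<^esub>" by (rule kill)
  moreover have "of_free (fgen Lx) = of_free (fgen Lx - fconst \<alpha>) + of_free (fconst \<alpha>)"
    by (simp flip: of_free_simps(1))
  ultimately have x: "rX v = rK \<alpha> v"
    using v by (simp add: rho_add_left)
  have gens: "rU (Poly_Mapping.single (\<xi> ^ i) 1) v = v" if i: "i < r" for i
  proof -
    let ?g = "\<lambda>i. H_class lam (of_group (\<xi> ^ (i - 1)) - of_group 0)"
    \<comment> \<open>Selects the summand \<open>Suc i\<close>: the ideal numbers its generators
      from 1, while the powers of \<xi> start at 0.\<close>
    let ?c = "\<lambda>j. if j = Suc i then \<one>\<^bsub>?H\<^esub> else \<zero>\<^bsub>?H\<^esub>"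
    have "(\<Oplus>\<^bsub>?H\<^esub> j\<in>{1..r}. ?c j \<otimes>\<^bsub>?H\<^esub> ?g j) = (\<Oplus>\<^bsub>?H\<^esub> j\<in>{1..r}. if Suc i = j then ?g j else \<zero>\<^bsub>?H\<^esub>)"
      by (intro V.R.finsum_cong') (auto simp: H_class_closed)
    also have "\<dots> = ?g (Suc i)"
      using i by (intro V.R.add.finprod_singleton) (auto simp: H_class_closed)
    finally have "?g (Suc i) \<in> ?N"
      using N_I[of "\<zero>\<^bsub>?H\<^esub>" ?c] by (simp add: H_class_closed)
    then have "rho (of_group (\<xi> ^ i) - of_group 0) v = \<zero>\<^bsub>V\<^esub>"
      using kill by simp
    moreover have "of_group (\<xi> ^ i) = (of_group (\<xi> ^ i) - of_group 0) + of_group 0" by simp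
    ultimately have "rho (of_group (\<xi> ^ i)) v = rho (of_group 0) v"
      using v by (metis V.M.l_zero rho_add_left rho_closed)
    then show ?thesis
      using rho_one[OF v] by (simp add: of_group_def of_group_alg_single del: single_one)
  qed
  \<comment> \<open>The stabiliser of v is closed under addition and contains r generators of
    E.\<close>
  have "{a. rU (Poly_Mapping.single a 1) v = v} = UNIV"
  proof (rule power_sum_generators[OF prime_CHAR card \<xi>])
    show "0 \<in> {a. rU (Poly_Mapping.single a 1) v = v}"
      using rho_one[OF v] by (simp add: of_group_alg_single del: single_one)
    show "a + b \<in> {a. rU (Poly_Mapping.single a 1) v = v}"
      if "a \<in> {a. rU (Poly_Mapping.single a 1) v = v}" "b \<in> {a. rU (Poly_Mapping.single a 1) v = v}" for a b
    proof -
      have "Poly_Mapping.single (a + b) 1 = Poly_Mapping.single a 1 * (Poly_Mapping.single b 1 :: 'f group_alg)"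
        by (simp add: mult_single)
      then show ?thesis using that v by (simp add: of_group_alg_mult rho_mult)
    qed
  qed (use gens in simp)
  then show ?thesis using that[OF v v0 x] by blast
qed

section \<open>A simple module as k[y] modulo a maximal stable ideal\<close>

locale H_cyclic = H_module lam \<alpha> V
  for lam :: "'f::{finite,field} group_alg" and \<alpha> and V :: "('f smash set, 'v) module" +
  fixes v
  assumes v_closed [simp]: "v \<in> carrier V" and v_nonzero: "v \<noteq> \<zero>\<^bsub>V\<^esub>"
    and x_v: "rX v = rK \<alpha> v" and g_v: "rU (Poly_Mapping.single a 1) v = v"
    and simple: "simple_module (H_alg lam) V"
begin

lemma rho_u_v: "rU u v = rK (aug u) v"
proof (induction u rule: poly_mapping_single_add_induct)
  case (single a c)
  have "Poly_Mapping.single a c = Poly_Mapping.single 0 c * (Poly_Mapping.single a 1 :: 'f group_alg)"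
    by (simp add: mult_single)
  then have "rU (Poly_Mapping.single a c) v = rK c (rU (Poly_Mapping.single a 1) v)"
    by (simp only: of_group_alg_mult rho_mult v_closed of_free_fconst)
  then show ?case by (simp add: g_v)
next
  case (add u w)
  then show ?case by (simp add: of_group_alg_add aug_add rho_add_left rho_const_add del: fconst_simps)
qed

lemma x_embed_v: "rho (x_embed P) v = rK (point \<alpha> P) v"
proof (induction P)
  case (pCons u P)
  have "rho (x_embed (pCons u P)) v = rK (aug u) v \<oplus>\<^bsub>V\<^esub> rX (rK (point \<alpha> P) v)"
    by (simp add: x_embed_pCons rho_add_left rho_mult rho_u_v pCons.IH)
  also have "rX (rK (point \<alpha> P) v) = rK (point \<alpha> P * \<alpha>) v"
    by (simp only: rho_x_const v_closed x_v rho_const_mult)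
  also have "rK (aug u) v \<oplus>\<^bsub>V\<^esub> \<dots> = rK (aug u + point \<alpha> P * \<alpha>) v"
    by (simp only: rho_const_add v_closed)
  finally show ?case by (simp add: mult.commute del: fconst_simps)
qed (simp add: of_free_def)

definition ev :: "'f alg_closure poly \<Rightarrow> 'v" where
  "ev m = rho (y_embed m) v"

lemma ev_closed [simp]: "ev m \<in> carrier V"
  by (simp add: ev_def)

lemma ev_0 [simp]: "ev 0 = \<zero>\<^bsub>V\<^esub>"
  by (simp add: ev_def)

lemma ev_pCons: "ev (pCons c m) = rK c v \<oplus>\<^bsub>V\<^esub> rY (ev m)"
  by (simp add: ev_def y_embed_pCons rho_add_left rho_mult)

lemma ev_const: "ev [:c:] = rK c v"
  by (simp add: ev_pCons)

lemma ev_1: "ev 1 = v"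
  by (simp only: one_pCons ev_const rho_const_1 v_closed)

lemma ev_add: "ev (m + n) = ev m \<oplus>\<^bsub>V\<^esub> ev n"
  by (simp add: ev_def y_embed_add rho_add_left)

lemma ev_mult: "ev (m * n) = rho (y_embed m) (ev n)"
  by (simp add: ev_def y_embed_mult rho_mult)

lemma ev_smult: "ev (Polynomial.smult c m) = rK c (ev m)"
  by (simp add: ev_def y_embed_smult rho_mult)

lemma ev_y: "rY (ev m) = ev (pCons 0 m)"
  by (simp add: ev_pCons of_free_def)

text \<open>This ties the operators \<open>L\<close> to the module: \<open>x_embed_v\<close>
  supplies the \<open>tau\<close> terms and \<open>rho_commutator\<close> the step past y.\<close>

lemma x_embed_ev: "rho (x_embed a) (ev m) = ev (L m a)"
proof (induction m arbitrary: a)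
  case (pCons c m)
  have "rho (x_embed a) (ev (pCons c m)) = rK c (rho (x_embed a) v) \<oplus>\<^bsub>V\<^esub>
      (rY (rho (x_embed a) (ev m)) \<oplus>\<^bsub>V\<^esub> rho (x_embed (comm_deriv lam a)) (ev m))"
    by (simp add: ev_pCons rho_add_right rho_x_embed_const rho_commutator)
  also have "\<dots> = ev [:c * point \<alpha> a:] \<oplus>\<^bsub>V\<^esub> (ev (pCons 0 (L m a)) \<oplus>\<^bsub>V\<^esub> ev (L m (comm_deriv lam a)))"
    by (simp only: pCons.IH ev_y x_embed_v ev_const rho_const_mult v_closed)
  finally show ?case by (simp add: add.assoc[symmetric] flip: ev_add)
qed simp

text \<open>y acts on values of \<open>ev\<close> by polynomial multiplication, and x and kE act
  through \<open>L\<close>, so the closure conditions of a stable ideal are those of a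
  submodule.\<close>

lemma ideal_image_submodule:
  assumes S: "stable_ideal S"
  shows "Module.submodule (ev ` S) (H_alg lam) V"
proof (rule submoduleI)
  show "ev ` S \<subseteq> carrier V" by auto
  show "\<zero>\<^bsub>V\<^esub> \<in> ev ` S"
    using S ev_0 by (metis image_eqI stable_ideal_def)
  show "u \<oplus>\<^bsub>V\<^esub> w \<in> ev ` S" if "u \<in> ev ` S" "w \<in> ev ` S" for u w
    using that S by (auto simp: stable_ideal_def simp flip: ev_add)
  have x_embed: "rho (x_embed a) u \<in> ev ` S" if "u \<in> ev ` S" for a u
    using that S by (auto simp: stable_ideal_def x_embed_ev)
  show "rX u \<in> ev ` S" if "u \<in> ev ` S" for u
  proof -
    have "x_embed [:0, 1:] = (of_free (fgen Lx) :: 'f smash)"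
      using smash_mult_one_right[of "of_free (fgen Lx)"] of_group_alg_single[of "0 :: 'f" 1]
      by (simp add: x_embed_pCons)
    then show ?thesis using x_embed[OF that, of "[:0, 1:]"] by simp
  qed
  show "rU w u \<in> ev ` S" if "u \<in> ev ` S" for w u
    using x_embed[OF that, of "[:w:]"] by (simp add: x_embed_pCons)
  show "rY u \<in> ev ` S" if u: "u \<in> ev ` S" for u
  proof -
    from u obtain m where m: "m \<in> S" "u = ev m" by auto
    then have "[:0, 1:] * m \<in> S" using S by (simp only: stable_ideal_def)
    then show ?thesis using m by (auto simp: ev_y)
  qed
qed

definition relations :: "'f alg_closure poly set" where
  "relations = {m. ev m = \<zero>\<^bsub>V\<^esub>}"

lemma stable_relations: "stable_ideal relations"
  by (auto simp: stable_ideal_def relations_def ev_add ev_mult simp flip: x_embed_ev)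

lemma submodule_cases:
  "Module.submodule N (H_alg lam) V \<Longrightarrow> N = {\<zero>\<^bsub>V\<^esub>} \<or> N = carrier V"
  using simple by (simp add: simple_module_def)

lemma one_notin_relations: "1 \<notin> relations"
  using v_nonzero by (simp add: relations_def ev_1)

text \<open>By simplicity the image of S is zero or all of V. In the second case v = ev s for some s
  in S, so 1 - s is a relation, and S contains 1.\<close>

lemma relations_maximal:
  assumes S: "stable_ideal S" "relations \<subseteq> S" "1 \<notin> S"
  shows "S \<subseteq> relations"
  using submodule_cases[OF ideal_image_submodule[OF S(1)]]
proof
  assume "ev ` S = {\<zero>\<^bsub>V\<^esub>}"
  then show ?thesis by (auto simp: relations_def)
next
  assume "ev ` S = carrier V"
  then obtain s where s: "s \<in> S" "v = ev s" using v_closed by blast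
  have "ev (1 - s) \<oplus>\<^bsub>V\<^esub> ev s = ev ((1 - s) + s)"
    by (simp only: ev_add)
  also have "\<dots> = \<zero>\<^bsub>V\<^esub> \<oplus>\<^bsub>V\<^esub> ev s"
    by (simp add: ev_1 s(2)[symmetric])
  finally have "ev (1 - s) \<oplus>\<^bsub>V\<^esub> ev s = \<zero>\<^bsub>V\<^esub> \<oplus>\<^bsub>V\<^esub> ev s" .
  then have "ev (1 - s) = \<zero>\<^bsub>V\<^esub>"
    by (metis V.M.add.r_cancel V.M.zero_closed ev_closed)
  then have "1 - s \<in> S" using S(2) by (auto simp: relations_def)
  then have "(1 - s) + s \<in> S" using S(1) s(1) unfolding stable_ideal_def by blast
  then show ?thesis using S(3) by simp
qed

lemma ev_surj: "range ev = carrier V"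
proof -
  have "stable_ideal UNIV" by (simp add: stable_ideal_def)
  from submodule_cases[OF ideal_image_submodule[OF this]]
  show ?thesis
  proof
    assume "range ev = {\<zero>\<^bsub>V\<^esub>}"
    then have "ev 1 = \<zero>\<^bsub>V\<^esub>" by blast
    then show ?thesis using v_nonzero by (simp add: ev_1)
  qed
qed

text \<open>Division by m0 represents every vector by a remainder of degree below n, uniquely by
  minimality, so V is isomorphic to k^n.\<close>

lemma has_k_dim_if_degree:
  assumes m0: "m0 \<in> relations" "degree m0 = n" "n > 0"
    and min: "\<And>m. m \<in> relations \<Longrightarrow> m \<noteq> 0 \<Longrightarrow> n \<le> degree m"
  shows "has_k_dim lam V n"
proof -
  let ?K = "ring_of_type_algebra :: 'f alg_closure ring"
  let ?W = "k_space lam V"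
  let ?U = "module_vec TYPE('f alg_closure) n"
  \<comment> \<open>The standard space of vectors lives over \<open>class_ring\<close>, the
    dimension in \<open>has_k_dim\<close> over \<open>ring_of_type_algebra\<close>; the two records
    coincide.\<close>
  have K: "class_ring = ?K"
    by (simp add: ring_of_type_algebra_def)
  interpret W: vectorspace ?K ?W
    by (rule vectorspace_k_space[OF V.left_module_axioms])
  interpret U: vec_space "TYPE('f alg_closure)" n .
  define pol where "pol w = (\<Sum>i<n. monom (w $ i) i)" for w :: "'f alg_closure vec"
  have coeff_pol: "coeff (pol w) i = (if i < n then w $ i else 0)" for w i
  proof -
    have "coeff (pol w) i = (\<Sum>j<n. if j = i then w $ i else 0)"
      unfolding pol_def coeff_sum by (intro sum.cong) auto
    then show ?thesis by simp
  qed
  have deg_pol: "pol w = 0 \<or> degree (pol w) < n" for w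
    using coeff_pol[of w "degree (pol w)"] by (metis leading_coeff_0_iff)
  have U_simps: "carrier ?U = carrier_vec n" "add ?U = (+)" "Module.smult ?U = (\<cdot>\<^sub>v)"
    by (simp_all add: module_vec_def)
  have W_simps: "carrier ?W = carrier V" "add ?W = add V" "Module.smult ?W c u = rK c u" for c u
    by (simp_all add: k_space_def rho_def)
  have K_carrier: "carrier ?K = UNIV"
    by (simp add: ring_of_type_algebra_def)
  have "linear_map ?K ?U ?W (\<lambda>w. ev (pol w))"
  proof (intro linear_map.intro mod_hom.intro mod_hom_axioms.intro)
    show "vectorspace ?K ?U" using U.vectorspace_axioms unfolding K .
    then show "module ?K ?U" by (rule vectorspace.axioms(1))
    show "vectorspace ?K ?W" by (rule W.vectorspace_axioms)
    then show "module ?K ?W" by (rule vectorspace.axioms(1))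
    show "(\<lambda>w. ev (pol w)) \<in> module_hom ?K ?U ?W"
      unfolding module_hom_def U_simps W_simps
    proof (intro CollectI conjI allI impI funcsetI)
      fix u w :: "'f alg_closure vec" assume "u \<in> carrier_vec n \<and> w \<in> carrier_vec n"
      then have "pol (u + w) = pol u + pol w"
        by (intro poly_eqI) (auto simp: coeff_pol)
      then show "ev (pol (u + w)) = ev (pol u) \<oplus>\<^bsub>V\<^esub> ev (pol w)"
        by (simp add: ev_add)
    next
      fix c and w :: "'f alg_closure vec" assume "c \<in> carrier ?K \<and> w \<in> carrier_vec n"
      then have "pol (c \<cdot>\<^sub>v w) = Polynomial.smult c (pol w)"
        by (intro poly_eqI) (auto simp: coeff_pol)
      then show "ev (pol (c \<cdot>\<^sub>v w)) = rK c (ev (pol w))"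
        by (simp add: ev_smult)
    qed simp
  qed
  then interpret lin: linear_map ?K ?U ?W "\<lambda>w. ev (pol w)" .
  have inj: "inj_on (\<lambda>w. ev (pol w)) (carrier ?U)"
  proof (rule inj_onI)
    fix u w assume u: "u \<in> carrier ?U" and w: "w \<in> carrier ?U" and eq: "ev (pol u) = ev (pol w)"
    have "pol (u - w) = pol u - pol w"
      using u w by (intro poly_eqI) (auto simp: coeff_pol U_simps)
    then have "ev (pol (u - w)) \<oplus>\<^bsub>V\<^esub> ev (pol w) = \<zero>\<^bsub>V\<^esub> \<oplus>\<^bsub>V\<^esub> ev (pol w)"
      using eq by (simp flip: ev_add)
    then have "ev (pol (u - w)) = \<zero>\<^bsub>V\<^esub>"
      by (metis V.M.add.r_cancel V.M.zero_closed ev_closed)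
    then have "pol (u - w) = 0"
      using min[of "pol (u - w)"] deg_pol[of "u - w"] by (fastforce simp: relations_def)
    then have "coeff (pol (u - w)) i = 0" for i by simp
    then have "(u - w) $ i = 0" if "i < n" for i
      using that by (metis coeff_pol)
    then show "u = w"
      using u w by (intro eq_vecI) (auto simp: U_simps)
  qed
  have surj: "(\<lambda>w. ev (pol w)) ` carrier ?U = carrier ?W"
  proof
    show "carrier ?W \<subseteq> (\<lambda>w. ev (pol w)) ` carrier ?U"
    proof
      fix u assume "u \<in> carrier ?W"
      then obtain m where m: "u = ev m" using ev_surj by (auto simp: W_simps)
      let ?r = "m mod m0"
      have m0_nz: "m0 \<noteq> 0" using m0 by auto
      have "ev m = ev (m div m0 * m0 + ?r)" by simp
      also have "\<dots> = ev ?r"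
        using m0(1) by (simp only: ev_add ev_mult relations_def mem_Collect_eq rho_zero V.M.l_zero ev_closed)
      finally have u: "u = ev ?r" using m by simp
      have "pol (vec n (coeff ?r)) = ?r"
        using degree_mod_less[OF m0_nz, of m] m0(2,3)
        by (intro poly_eqI) (auto simp: coeff_pol coeff_eq_0)
      then show "u \<in> (\<lambda>w. ev (pol w)) ` carrier ?U"
        using u by (intro image_eqI[of _ _ "vec n (coeff ?r)"]) (auto simp: U_simps)
    qed
  qed (auto simp: W_simps)
  have fin: "vectorspace.fin_dim ?K ?U" using U.fin_dim unfolding K .
  have "vectorspace.dim ?K ?U = n" using U.dim_is_n unfolding K .
  then show ?thesis
    using lin.dim_eq[OF fin inj surj] lin.surj_fin_dim[OF fin surj] by (simp add: has_k_dim_def)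
qed

lemma has_k_dim_if_critical:
  assumes "critical s"
  shows "has_k_dim lam V (CHAR('f) ^ s)"
proof -
  obtain b j0 where b: "j0 \<le> s" "b j0 \<noteq> 0" "\<And>a. (\<Sum>j\<le>s. b j * T (CHAR('f alg_closure) ^ j) a) = 0"
    and indep: "\<And>b. (\<And>a. (\<Sum>j<s. b j * T (CHAR('f alg_closure) ^ j) a) = 0) \<Longrightarrow> \<forall>j<s. b j = 0"
    using assms unfolding critical_def by blast
  have p: "prime CHAR('f alg_closure)" using prime_CHAR by simp
  obtain m0 where "m0 \<in> relations" "degree m0 = CHAR('f alg_closure) ^ s"
    and "\<And>m. m \<in> relations \<Longrightarrow> m \<noteq> 0 \<Longrightarrow> CHAR('f alg_closure) ^ s \<le> degree m"
    using maximal_stable_ideal_degree[OF p indep b(3,1,2) stable_relations one_notin_relations relations_maximal]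
    by blast
  then show ?thesis
    using has_k_dim_if_degree[of m0 "CHAR('f) ^ s"] prime_gt_0_nat[OF prime_CHAR] by simp
qed

end

theorem theorem6p17:
  fixes p r :: nat
    and \<xi> :: "'f::{finite,field}"
    and lam :: "'f group_alg"
    and V :: "('f smash set, 'v) module"
  assumes "prime p" and "odd p" and "r \<ge> 1" and "CARD('f) = p ^ r"
    and "range (\<lambda>n::nat. \<xi> ^ n) = UNIV - {0}"
    and "lam \<noteq> 0"
    and "Poly_Mapping.lookup lam 0 = 0 \<or> Poly_Mapping.lookup lam 0 = 1"
    and "simple_module (H_alg lam) V"
  shows "(is_quotient_of (H_alg lam) V (Delta lam \<xi> r 0) \<longrightarrow>
            (lam \<notin> jacobson_radical ring_of_type_algebra \<longrightarrow> has_k_dim lam V p) \<and>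
            (lam \<in> jacobson_radical ring_of_type_algebra \<longrightarrow> has_k_dim lam V 1)) \<and>
         (\<forall>\<alpha>. \<alpha> \<noteq> 0 \<longrightarrow> is_quotient_of (H_alg lam) V (Delta lam \<xi> r \<alpha>) \<longrightarrow>
            (Poly_Mapping.lookup lam 0 = 0 \<longrightarrow> has_k_dim lam V (p ^ r)) \<and>
            (Poly_Mapping.lookup lam 0 = 1 \<longrightarrow> has_k_dim lam V (p * p ^ r)))"
proof -
  \<comment> \<open>The characteristic is a prime dividing the order p^r, hence equal to p.\<close>
  have "prime CHAR('f)" by (rule prime_CHAR_finite)
  moreover have "CHAR('f) dvd p ^ r"
    using CHAR_dvd_CARD[where ?'a = 'f] assms(4) by simp
  ultimately have p: "p = CHAR('f)"
    using assms(1) by (metis prime_dvd_power primes_dvd_imp_eq)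
  have odd: "odd CHAR('f)" and card: "CARD('f) = CHAR('f) ^ r"
    using assms(2,4) by (simp_all add: p)
  have V: "left_module (H_alg lam) V" and nontriv: "carrier V \<noteq> {\<zero>\<^bsub>V\<^esub>}"
    using assms(8) by (simp_all add: simple_module_def)
  \<comment> \<open>All four cases reduce to the critical exponent, which is 1, 0, r and r + 1 in
    the order treated below.\<close>
  have dim: "has_k_dim lam V (CHAR('f) ^ s)"
    if quot: "is_quotient_of (H_alg lam) V (Delta lam \<xi> r \<alpha>)"
      and s: "derivation_at_point.critical (comm_deriv lam) (point \<alpha>) s" for \<alpha> s
  proof -
    interpret H_module lam \<alpha> V by (intro H_module.intro V)
    obtain v where "v \<in> carrier V" "v \<noteq> \<zero>\<^bsub>V\<^esub>" "rX v = rK \<alpha> v"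
      "\<And>a. rU (Poly_Mapping.single a 1) v = v"
      using quotient_generator[OF quot nontriv card assms(5)] by blast
    then interpret H_cyclic lam \<alpha> V v
      using assms(8) by (intro H_cyclic.intro H_cyclic_axioms.intro H_module_axioms)
    show ?thesis using s by (rule has_k_dim_if_critical)
  qed
  show ?thesis
  proof (intro conjI impI allI)
    assume quot: "is_quotient_of (H_alg lam) V (Delta lam \<xi> r 0)"
    show "has_k_dim lam V p" if "lam \<notin> jacobson_radical ring_of_type_algebra"
      using dim[OF quot crossed_data.critical_1[OF refl _ odd]] that
      by (simp add: p jacobson_radical_group_alg)
    show "has_k_dim lam V 1" if "lam \<in> jacobson_radical ring_of_type_algebra"
      using dim[OF quot crossed_data.critical_0[OF refl]] that
      by (simp add: jacobson_radical_group_alg)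
  next
    fix \<alpha> :: "'f alg_closure"
    assume \<alpha>: "\<alpha> \<noteq> 0" and quot: "is_quotient_of (H_alg lam) V (Delta lam \<xi> r \<alpha>)"
    show "has_k_dim lam V (p ^ r)" if "Poly_Mapping.lookup lam 0 = 0"
      using dim[OF quot crossed_data.critical_t0[OF \<alpha> that odd card assms(5)]] by (simp only: p)
    show "has_k_dim lam V (p * p ^ r)" if "Poly_Mapping.lookup lam 0 = 1"
      using dim[OF quot crossed_data.critical_t1[OF \<alpha> that odd card assms(5,3)]] by (simp only: p power_Suc)
  qed
qed

end
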